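(* Let $\mathcal F$ be a standard construction, let $V_n=\mathcal F(\mathbb R^n)$, let $\mathcal F(\mathcal Z)$ be the associated $\mathcal Z$-sequence with embeddings $\varphi_{N,n}=\mathcal F(\zeta_{N,n}):V_n\to V_N$ ($n\le N$), and let $\mathcal F(\mathcal D)$ be the corresponding $\mathcal D$-sequence with embeddings $\psi_{N,n}=\mathcal F(\delta_{N,n}):V_n\to V_N$ ($n\mid N$). Let $(\Omega_n\subseteq V_n)_n$ be a sequence of $\mathfrak S_n$-invariant sets satisfying $\varphi_{N,n}^\star\Omega_N\subseteq\Omega_n$ whenever $n\le N$ and $\psi_{N,n}\Omega_n\subseteq\Omega_N$ whenever $n\mid N$. Consider the map from freely-symmetrized measures $\varinjlim_{\mathcal F(\mathcal D)}\mathcal P(\Omega_n)^{\mathfrak S_n}$ over $\mathcal F(\mathcal D)$ to freely-described measures $\varprojlim_{\mathcal F(\mathcal Z)}\mathcal P(\Omega_m)^{\mathfrak S_m}$ over $\mathcal F(\mathcal Z)$ sending $$\left(\mathrm{sym}_N^{\mathcal F(\mathcal D)}\mu_n\right)_{n\mid N}\ \mapsto\ \big(\mathrm{Law}(\rho(F_{n,m})X)\big)_m,$$ where $X\sim\mu_n$ is independent of the uniformly random map $F_{n,m}:[m]\to[n]$. This map has a dense image in total variation, meaning that for any freely-described measure $(\mu_m)\in\varprojlim_{\mathcal F(\mathcal Z)}\mathcal P(\Omega_m)^{\mathfrak S_m}$ there exist $(\mu_m^{(n)})_m$, $n=1,2,\dots$, in the image of this map such that $\lim_{n\to\infty}\|\mu_m-\mu_m^{(n)}\|_{\mathrm{TV}}=0$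 for each $m$. More precisely, for any $m\le n$ and any $\mu_n\in\mathcal P(V_n)^{\mathfrak S_n}$ we have $$\big\|\mathrm{Law}(\varphi_{n,m}^\star X)-\mathrm{Law}(\rho(F_{n,m})X)\big\|_{\mathrm{TV}}\le\frac{m(m-1)}{n},$$ where $X\sim\mu_n$ is independent of $F_{n,m}$.
   Context: Conventions. Dimension indices $n,m,k,N,M$ are positive integers; $[n]=\{1,\dots,n\}$; $n\mid N$ is divisibility; $\mathfrak S_n$ is the symmetric group on $[n]$. Vector spaces are finite-dimensional real inner product spaces and $A^\star$ is the adjoint of $A$. $\mathbb R^n$ has its standard basis and inner product, and $\mathfrak S_n$ acts by $(\sigma x)_i=x_{\sigma^{-1}(i)}$. Standard constructions. A standard construction $\mathcal F$ is built inductively from the identity construction using finitely many of the following operations, each producing spaces $\mathcal F(\mathbb R^n)$ and, for each linear $A:\mathbb R^n\to\mathbb R^m$, a linear map $\mathcal F(A):\mathcal F(\mathbb R^n)\to\mathcal F(\mathbb R^m)$: the product $\mathcal F_1\times\mathcal F_2$ (with $\mathcal F_1(A)\times\mathcal F_2(A)$); the tensor product $\mathcal F_1\otimes\mathcal F_2$ (with $\mathcal F_1(A)\otimes\mathcal F_2(A)$); the symmetric power $\mathrm{Sym}^k\mathcal F_1$, viewed as symmetric tensors (with $\mathcal F_1(A)^{\otimes k}$ restricted to symmetric tensors); and homogeneous degree-$k$ polynomials $\mathbb R[\mathcal F_1]_k$ over $\mathcal F_1(\mathbb R^n)$ (with $p\mapsto p\circ\mathcal F_1(A)^\star$); $\mathbb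 R[\mathcal F_1]_0=\mathbb R$ is trivial, and $\mathbb R[\mathcal F_1]_{\le k}=\mathbb R[\mathcal F_1]_0\times\cdots\times\mathbb R[\mathcal F_1]_k$. Bases and inner products. If $(e_\alpha)_{\alpha\in\mathcal A}$, $(e_\beta)_{\beta\in\mathcal B}$ are the orthogonal bases of $W,U$: $W\times U$ has basis $(e_\alpha,0),(0,e_\beta)$ and the sum inner product; $W\otimes U$ has basis $e_\alpha\otimes e_\beta$ and the product inner product; $\mathrm{Sym}^kW$ has basis the orbit sums $E_{[\alpha_1,\dots,\alpha_k]}=\sum e_{\alpha_1'}\otimes\cdots\otimes e_{\alpha_k'}$ over distinct rearrangements $(\alpha_i')$ of $(\alpha_i)$, and the inner product making $E_{[\alpha_1,\dots,\alpha_k]}/\sqrt{\prod_i\langle e_{\alpha_i},e_{\alpha_i}\rangle}$ orthonormal; $\mathbb R[W]_k$ has basis the monomials $m_\mu(x)=\prod_\alpha\langle x,e_\alpha\rangle^{\mu_\alpha}$, $|\mu|=k$, and the Bombieri inner product making $m_\mu\big/\sqrt{\tfrac{\mu!}{k!}\prod_\alpha\langle e_\alpha,e_\alpha\rangle^{\mu_\alpha}}$ orthonormal. Maps between finite sets. For $f:[m]\to[n]$ let $\rho(f):\mathbb R^n\to\mathbb R^m$, $(\rho(f)x)_i=x_{f(i)}$; also write $\rho(f)$ for $\mathcal F(\rho(f)):V_n\to V_m$. Sequences. $\mathcal Z$ consists of $(\mathbb R^n)$ with zero-padding embeddings $\zeta_{N,n}(x)=(x,0_{N-n})$ for $n\le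 N$; $\mathcal D$ consists of $(\mathbb R^n)$ with duplication embeddings $\delta_{N,n}(x)=x\otimes\mathbf 1_{N/n}=(x_1,\dots,x_1,\dots,x_n,\dots,x_n)$ (each entry repeated $N/n$ times) for $n\mid N$. $\mathcal F(\mathcal Z)$ and $\mathcal F(\mathcal D)$ are the spaces $V_n=\mathcal F(\mathbb R^n)$ with $\mathfrak S_n$-action $\mathcal F(\sigma)$ and embeddings $\mathcal F(\zeta_{N,n})$, resp. $\mathcal F(\delta_{N,n})$. Measures. $\mathcal P(\Omega)$ is the set of Borel probability measures on $\Omega$, and $\mathcal P(\Omega)^{\mathfrak S_n}$ the $\mathfrak S_n$-invariant ones. $\varprojlim_{\mathcal F(\mathcal Z)}\mathcal P(\Omega_m)^{\mathfrak S_m}$ is the set of sequences $(\mu_m)_m$ with $\mu_m\in\mathcal P(\Omega_m)^{\mathfrak S_m}$ such that the pushforward of $\mu_M$ under $\varphi_{M,m}^\star$ is $\mu_m$ for all $m\le M$. For $n\mid N$ and $\mu_n\in\mathcal P(\Omega_n)^{\mathfrak S_n}$, $\mathrm{sym}_N^{\mathcal F(\mathcal D)}\mu_n=\mathrm{Law}(\Pi_N\psi_{N,n}X)$ with $X\sim\mu_n$ and $\Pi_N$ an independent uniformly random element of $\mathfrak S_N$. $\varinjlim_{\mathcal F(\mathcal D)}\mathcal P(\Omega_n)^{\mathfrak S_n}$ is the disjoint union $\bigsqcup_n\mathcal P(\Omega_n)^{\mathfrak S_n}$ modulo the equivalence relation generated by $\mu_n\sim\mathrm{sym}_N^{\mathcal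 F(\mathcal D)}\mu_n$ for $n\mid N$; the class of $\mu_n$ is written $(\mathrm{sym}_N^{\mathcal F(\mathcal D)}\mu_n)_{n\mid N}$. Total variation is normalized as $\|\mu-\nu\|_{\mathrm{TV}}=\sup_{h:\Omega\to[-1,1]}|\mathbb E_\mu h-\mathbb E_\nu h|$ ($h$ measurable), i.e. $\sum_x|\mu(x)-\nu(x)|$ on a finite set. *)

theory Defs
  imports "HOL-Probability.Probability" "HOL-Library.Multiset"
begin

text \<open>
  A vector of \<open>\<real>\<^sup>n\<close> is a function \<open>nat \<Rightarrow> real\<close> vanishing outside \<open>{1..n}\<close>.  The operation
  \<open>Sym\<^sup>0\<close> yields the trivial construction \<open>\<real>\<close>, just like \<open>\<real>[F]\<^sub>0\<close>.
\<close>

datatype std_constr =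
    Ident
  | Product std_constr std_constr
  | Tensor std_constr std_constr
  | SymPower nat std_constr
  | HomPoly nat std_constr

text \<open>
  Since \<open>n\<close> varies, all spaces \<open>F(\<real>\<^sup>n)\<close> live in one type: an element is represented by its
  coordinates with respect to the orthogonal basis of \<open>F(\<real>\<^sup>n)\<close>, i.e. by a function on labels
  vanishing outside the finite set \<open>basis F n\<close> of labels of basis vectors.  The label \<open>Mset M\<close>
  stands for the orbit sum \<open>E\<^bsub>[\<alpha>\<^sub>1,\<dots>,\<alpha>\<^sub>k]\<^esub>\<close> with \<open>M = {#\<alpha>\<^sub>1,\<dots>,\<alpha>\<^sub>k#}\<close> in a symmetric power, and for
  the monomial \<open>m\<^sub>\<mu>\<close> with \<open>\<mu> = count M\<close> in a space of polynomials.
\<close>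

datatype label =
    Coord nat
  | InLeft label
  | InRight label
  | LPair label label
  | Mset "label multiset"

type_synonym vec = "label \<Rightarrow> real"

primrec basis :: "std_constr \<Rightarrow> nat \<Rightarrow> label set" where
  "basis Ident n = Coord ` {1..n}"
| "basis (Product F G) n = InLeft ` basis F n \<union> InRight ` basis G n"
| "basis (Tensor F G) n = (\<lambda>(a, b). LPair a b) ` (basis F n \<times> basis G n)"
| "basis (SymPower k F) n = Mset ` {M. set_mset M \<subseteq> basis F n \<and> size M = k}"
| "basis (HomPoly k F) n = Mset ` {M. set_mset M \<subseteq> basis F n \<and> size M = k}"

text \<open>\<open>sqnorm F a\<close> is \<open>\<langle>e\<^sub>a, e\<^sub>a\<rangle>\<close>; the last equation is the Bombieri inner product.\<close>

primrec sqnorm :: "std_constr \<Rightarrow> label \<Rightarrow> real" where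
  "sqnorm Ident a = 1"
| "sqnorm (Product F G) a =
    (case a of InLeft b \<Rightarrow> sqnorm F b | InRight c \<Rightarrow> sqnorm G c | _ \<Rightarrow> 0)"
| "sqnorm (Tensor F G) a = (case a of LPair b c \<Rightarrow> sqnorm F b * sqnorm G c | _ \<Rightarrow> 0)"
| "sqnorm (SymPower k F) a =
    (case a of Mset M \<Rightarrow> (\<Prod>b\<in>#M. sqnorm F b) | _ \<Rightarrow> 0)"
| "sqnorm (HomPoly k F) a =
    (case a of
       Mset M \<Rightarrow> (\<Prod>b\<in>set_mset M. fact (count M b)) / fact k * (\<Prod>b\<in>#M. sqnorm F b)
     | _ \<Rightarrow> 0)"

definition space_of :: "std_constr \<Rightarrow> nat \<Rightarrow> vec set" where
  "space_of F n = {x. \<forall>a. a \<notin> basis F n \<longrightarrow> x a = 0}"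

definition unit_vec :: "label \<Rightarrow> vec" where
  "unit_vec a = (\<lambda>b. if b = a then 1 else 0)"

definition ip :: "std_constr \<Rightarrow> nat \<Rightarrow> vec \<Rightarrow> vec \<Rightarrow> real" where
  "ip F n x y = (\<Sum>a\<in>basis F n. sqnorm F a * x a * y a)"

text \<open>The adjoint \<open>F(\<real>\<^sup>m) \<rightarrow> F(\<real>\<^sup>n)\<close> of a linear map \<open>L : F(\<real>\<^sup>n) \<rightarrow> F(\<real>\<^sup>m)\<close>.\<close>

definition adj :: "std_constr \<Rightarrow> nat \<Rightarrow> nat \<Rightarrow> (vec \<Rightarrow> vec) \<Rightarrow> vec \<Rightarrow> vec" where
  "adj F n m L y =
    (THE z. z \<in> space_of F n \<and> (\<forall>x\<in>space_of F n. ip F m (L x) y = ip F n x z))"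

text \<open>
  \<open>sym_tensor k x\<close> is the symmetric tensor \<open>\<Sum>\<^sub>M x\<^sub>M E\<^sub>M\<close> represented by \<open>x\<close>, as an element of the
  \<open>k\<close>-th tensor power: its coefficient at \<open>e\<^bsub>\<alpha>\<^sub>1\<^esub> \<otimes> \<dots> \<otimes> e\<^bsub>\<alpha>\<^sub>k\<^esub>\<close> is \<open>x\<^sub>M\<close> for \<open>M = {#\<alpha>\<^sub>1,\<dots>,\<alpha>\<^sub>k#}\<close>.
  \<open>tensor_power B k L\<close> is \<open>L\<^sup>\<otimes>\<^sup>k\<close> on the \<open>k\<close>-th tensor power of the space with basis labels \<open>B\<close>.
\<close>

definition sym_tensor :: "nat \<Rightarrow> vec \<Rightarrow> label list \<Rightarrow> real" where
  "sym_tensor k x as = (if length as = k then x (Mset (mset as)) else 0)"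

definition tensor_power ::
    "label set \<Rightarrow> nat \<Rightarrow> (vec \<Rightarrow> vec) \<Rightarrow> (label list \<Rightarrow> real) \<Rightarrow> label list \<Rightarrow> real" where
  "tensor_power B k L t bs =
    (if length bs = k
     then \<Sum>as\<in>{as. set as \<subseteq> B \<and> length as = k}. t as * (\<Prod>i<k. L (unit_vec (as ! i)) (bs ! i))
     else 0)"

definition tensor_map ::
    "label set \<Rightarrow> label set \<Rightarrow> (vec \<Rightarrow> vec) \<Rightarrow> (vec \<Rightarrow> vec) \<Rightarrow> vec \<Rightarrow> vec" where
  "tensor_map B C L K t = (\<lambda>c. case c of
     LPair a' b' \<Rightarrow> \<Sum>a\<in>B. \<Sum>b\<in>C. t (LPair a b) * (L (unit_vec a) a' * K (unit_vec b) b')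
   | _ \<Rightarrow> 0)"

text \<open>
  The polynomial function \<open>\<Sum>\<^sub>\<mu> c\<^sub>\<mu> m\<^sub>\<mu>\<close> on \<open>F(\<real>\<^sup>n)\<close>, where
  \<open>m\<^sub>\<mu>(x) = \<Prod>\<^sub>\<alpha> \<langle>x, e\<^sub>\<alpha>\<rangle>\<close> to the power \<open>\<mu>\<^sub>\<alpha>\<close>.
\<close>

definition poly_fun :: "std_constr \<Rightarrow> nat \<Rightarrow> nat \<Rightarrow> vec \<Rightarrow> vec \<Rightarrow> real" where
  "poly_fun F n k c x =
    (\<Sum>M\<in>{M. set_mset M \<subseteq> basis F n \<and> size M = k}.
       c (Mset M) * (\<Prod>a\<in>#M. ip F n x (unit_vec a)))"

text \<open>
  \<open>fmap F n m A\<close> is \<open>F(A) : F(\<real>\<^sup>n) \<rightarrow> F(\<real>\<^sup>m)\<close> for a linear map \<open>A : \<real>\<^sup>n \<rightarrow> \<real>\<^sup>m\<close>.  Symmetric tensors and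
  polynomials determine their coordinates, so the descriptions below are unique.
\<close>

primrec fmap ::
    "std_constr \<Rightarrow> nat \<Rightarrow> nat \<Rightarrow> ((nat \<Rightarrow> real) \<Rightarrow> nat \<Rightarrow> real) \<Rightarrow> vec \<Rightarrow> vec" where
  "fmap Ident n m A = (\<lambda>x c. case c of Coord i \<Rightarrow> A (\<lambda>j. x (Coord j)) i | _ \<Rightarrow> 0)"
| "fmap (Product F G) n m A = (\<lambda>x c. case c of
      InLeft a \<Rightarrow> fmap F n m A (\<lambda>b. x (InLeft b)) a
    | InRight a \<Rightarrow> fmap G n m A (\<lambda>b. x (InRight b)) a
    | _ \<Rightarrow> 0)"
| "fmap (Tensor F G) n m A = tensor_map (basis F n) (basis G n) (fmap F n m A) (fmap G n m A)"
| "fmap (SymPower k F) n m A = (\<lambda>x. THE y. y \<in> space_of (SymPower k F) m \<and>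
      sym_tensor k y = tensor_power (basis F n) k (fmap F n m A) (sym_tensor k x))"
| "fmap (HomPoly k F) n m A = (\<lambda>c. THE d. d \<in> space_of (HomPoly k F) m \<and>
      (\<forall>y\<in>space_of F m. poly_fun F m k d y = poly_fun F n k c (adj F n m (fmap F n m A) y)))"

definition perm_map :: "(nat \<Rightarrow> nat) \<Rightarrow> (nat \<Rightarrow> real) \<Rightarrow> nat \<Rightarrow> real" where
  "perm_map \<sigma> x = (\<lambda>i. x (inv \<sigma> i))"

definition zero_pad :: "nat \<Rightarrow> (nat \<Rightarrow> real) \<Rightarrow> nat \<Rightarrow> real" where
  "zero_pad n x = (\<lambda>i. if i \<in> {1..n} then x i else 0)"

definition duplicate :: "nat \<Rightarrow> nat \<Rightarrow> (nat \<Rightarrow> real) \<Rightarrow> nat \<Rightarrow> real" where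
  "duplicate n N x = (\<lambda>i. if i \<in> {1..N} then x ((i - 1) div (N div n) + 1) else 0)"

definition pullback :: "nat \<Rightarrow> (nat \<Rightarrow> nat) \<Rightarrow> (nat \<Rightarrow> real) \<Rightarrow> nat \<Rightarrow> real" where
  "pullback m f x = (\<lambda>i. if i \<in> {1..m} then x (f i) else 0)"

definition act :: "std_constr \<Rightarrow> nat \<Rightarrow> (nat \<Rightarrow> nat) \<Rightarrow> vec \<Rightarrow> vec" where
  "act F n \<sigma> = fmap F n n (perm_map \<sigma>)"

text \<open>\<open>\<phi>\<^bsub>N,n\<^esub>\<close>, its adjoint, \<open>\<psi>\<^bsub>N,n\<^esub>\<close>, and \<open>\<rho>(f)\<close> for \<open>f : [m] \<rightarrow> [n]\<close>.\<close>

definition phi :: "std_constr \<Rightarrow> nat \<Rightarrow> nat \<Rightarrow> vec \<Rightarrow> vec" where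
  "phi F N n = fmap F n N (zero_pad n)"

definition phi_adj :: "std_constr \<Rightarrow> nat \<Rightarrow> nat \<Rightarrow> vec \<Rightarrow> vec" where
  "phi_adj F N n = adj F n N (phi F N n)"

definition psi :: "std_constr \<Rightarrow> nat \<Rightarrow> nat \<Rightarrow> vec \<Rightarrow> vec" where
  "psi F N n = fmap F n N (duplicate n N)"

definition rho :: "std_constr \<Rightarrow> nat \<Rightarrow> nat \<Rightarrow> (nat \<Rightarrow> nat) \<Rightarrow> vec \<Rightarrow> vec" where
  "rho F n m f = fmap F n m (pullback m f)"

text \<open>
  The type \<open>vec\<close> carries the product topology, which induces the usual topology on each
  finite-dimensional space \<open>space_of F n\<close>.
\<close>

definition borel_on :: "vec set \<Rightarrow> vec measure" where
  "borel_on \<Omega> = restrict_space borel \<Omega>"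

definition prob_measures :: "vec set \<Rightarrow> vec measure set" where
  "prob_measures \<Omega> = {\<mu>. prob_space \<mu> \<and> sets \<mu> = sets (borel_on \<Omega>)}"

definition perms :: "nat \<Rightarrow> (nat \<Rightarrow> nat) set" where
  "perms n = {\<sigma>. \<sigma> permutes {1..n}}"

definition inv_measures :: "std_constr \<Rightarrow> nat \<Rightarrow> vec set \<Rightarrow> vec measure set" where
  "inv_measures F n \<Omega> =
    {\<mu> \<in> prob_measures \<Omega>. \<forall>\<sigma>\<in>perms n. distr \<mu> (borel_on \<Omega>) (act F n \<sigma>) = \<mu>}"

text \<open>Sequences are indexed by positive integers, hence restricted to \<open>{1..}\<close>.\<close>

definition inverse_limit :: "std_constr \<Rightarrow> (nat \<Rightarrow> vec set) \<Rightarrow> (nat \<Rightarrow> vec measure) set" where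
  "inverse_limit F \<Omega> =
    {\<mu> \<in> (\<Pi>\<^sub>E m\<in>{1..}. inv_measures F m (\<Omega> m)).
       \<forall>m M. 1 \<le> m \<and> m \<le> M \<longrightarrow> distr (\<mu> M) (borel_on (\<Omega> m)) (phi_adj F M m) = \<mu> m}"

definition symmetrize ::
    "std_constr \<Rightarrow> (nat \<Rightarrow> vec set) \<Rightarrow> nat \<Rightarrow> nat \<Rightarrow> vec measure \<Rightarrow> vec measure" where
  "symmetrize F \<Omega> N n \<mu> =
    distr (\<mu> \<Otimes>\<^sub>M uniform_count_measure (perms N)) (borel_on (\<Omega> N))
      (\<lambda>(x, \<pi>). act F N \<pi> (psi F N n x))"

definition level_measures :: "std_constr \<Rightarrow> (nat \<Rightarrow> vec set) \<Rightarrow> (nat \<times> vec measure) set" where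
  "level_measures F \<Omega> = (SIGMA n:{1..}. inv_measures F n (\<Omega> n))"

definition sym_step ::
    "std_constr \<Rightarrow> (nat \<Rightarrow> vec set) \<Rightarrow> ((nat \<times> vec measure) \<times> (nat \<times> vec measure)) set" where
  "sym_step F \<Omega> =
    {((n, \<mu>), (N, symmetrize F \<Omega> N n \<mu>)) | n N \<mu>.
       (n, \<mu>) \<in> level_measures F \<Omega> \<and> 1 \<le> N \<and> n dvd N}"

text \<open>The equivalence relation generated by \<open>sym_step\<close>, and its quotient.\<close>

definition sym_equiv ::
    "std_constr \<Rightarrow> (nat \<Rightarrow> vec set) \<Rightarrow> ((nat \<times> vec measure) \<times> (nat \<times> vec measure)) set" where
  "sym_equiv F \<Omega> = (sym_step F \<Omega> \<union> (sym_step F \<Omega>)\<inverse>)\<^sup>*"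

definition direct_limit ::
    "std_constr \<Rightarrow> (nat \<Rightarrow> vec set) \<Rightarrow> (nat \<times> vec measure) set set" where
  "direct_limit F \<Omega> = level_measures F \<Omega> // sym_equiv F \<Omega>"

definition sym_class ::
    "std_constr \<Rightarrow> (nat \<Rightarrow> vec set) \<Rightarrow> nat \<Rightarrow> vec measure \<Rightarrow> (nat \<times> vec measure) set" where
  "sym_class F \<Omega> n \<mu> = sym_equiv F \<Omega> `` {(n, \<mu>)}"

text \<open>\<open>Law(\<rho>(F\<^bsub>n,m\<^esub>)X)\<close> for independent \<open>X \<sim> \<mu>\<close> and uniformly random \<open>F\<^bsub>n,m\<^esub> : [m] \<rightarrow> [n]\<close>.\<close>

definition random_map_law ::
    "std_constr \<Rightarrow> nat \<Rightarrow> nat \<Rightarrow> vec set \<Rightarrow> vec measure \<Rightarrow> vec measure" where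
  "random_map_law F n m \<Omega> \<mu> =
    distr (\<mu> \<Otimes>\<^sub>M uniform_count_measure ({1..m} \<rightarrow>\<^sub>E {1..n})) (borel_on \<Omega>)
      (\<lambda>(x, f). rho F n m f x)"

definition random_map_seq ::
    "std_constr \<Rightarrow> (nat \<Rightarrow> vec set) \<Rightarrow> nat \<Rightarrow> vec measure \<Rightarrow> nat \<Rightarrow> vec measure" where
  "random_map_seq F \<Omega> n \<mu> = (\<lambda>m\<in>{1..}. random_map_law F n m (\<Omega> m) \<mu>)"

text \<open>
  The induced map on classes; \<open>the_elem\<close> picks the common value on all representatives, whose
  existence has to be proved.
\<close>

definition sampling_map ::
    "std_constr \<Rightarrow> (nat \<Rightarrow> vec set) \<Rightarrow> (nat \<times> vec measure) set \<Rightarrow> nat \<Rightarrow> vec measure" where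
  "sampling_map F \<Omega> C = the_elem ((\<lambda>(n, \<mu>). random_map_seq F \<Omega> n \<mu>) ` C)"

definition tv_dist :: "'a measure \<Rightarrow> 'a measure \<Rightarrow> real" where
  "tv_dist \<mu> \<nu> =
    (SUP h\<in>{h \<in> borel_measurable \<mu>. \<forall>x\<in>space \<mu>. h x \<in> {-1..1}}.
       \<bar>integral\<^sup>L \<mu> h - integral\<^sup>L \<nu> h\<bar>)"

end

theory Submission
  imports Defs
begin

text \<open>
  In coordinates, \<open>F(\<rho>(f))\<close> for \<open>f : [m] \<rightarrow> [n]\<close> is a weighted pullback along the induced map of
  basis labels; the weights are products of multinomial coefficients, and all equal 1 when \<open>f\<close> is an
  inclusion.  So \<open>\<phi>\<^sup>\<star>\<close>, the permutations, \<open>\<psi>\<close> and \<open>\<rho>(f)\<close> are all of this form and compose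
  contravariantly.  The sampling map is well defined because composing a uniformly random
  \<open>[m] \<rightarrow> [N]\<close> with a permutation and the equal-fibre map \<open>[N] \<rightarrow> [n]\<close> gives a uniformly random
  \<open>[m] \<rightarrow> [n]\<close>, and it lands in the inverse limit because restricting a uniformly random map gives
  a uniformly random map.  For injective \<open>f\<close>, invariance of \<open>\<mu>\<close> makes \<open>\<rho>(f)X\<close> and \<open>\<phi>\<^sup>\<star>X\<close>
  equal in law, so the total variation distance is at most twice the collision probability of a
  random map, which is at most \<open>m(m - 1)/(2n)\<close>; density follows by approximating \<open>(\<mu>\<^sub>m)\<close> by the
  images of the \<open>\<mu>\<^sub>n\<close>.
\<close>

section \<open>Maps induced on the coordinates of a standard construction\<close>

primrec relabel :: "(nat \<Rightarrow> nat) \<Rightarrow> label \<Rightarrow> label" where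
  "relabel f (Coord i) = Coord (f i)"
| "relabel f (InLeft a) = InLeft (relabel f a)"
| "relabel f (InRight a) = InRight (relabel f a)"
| "relabel f (LPair a b) = LPair (relabel f a) (relabel f b)"
| "relabel f (Mset M) = Mset (image_mset (relabel f) M)"

text \<open>This is \<open>\<mu>!\<close> for the exponent vector \<open>\<mu> = count M\<close> of
  a monomial. Its value at an image of \<open>M\<close>, divided by its value at \<open>M\<close>,
  is a product of multinomial coefficients.\<close>

definition mset_fact :: "'a multiset \<Rightarrow> real" where
  "mset_fact M = (\<Prod>a\<in>set_mset M. fact (count M a))"

text \<open>
  The coefficients of \<open>F(\<rho>(f))\<close>: the image of a monomial under \<open>F(\<rho>(f))\<close> is a product of sums over
  the fibres of \<open>f\<close>, whose expansion produces the multinomial factor in the case \<open>HomPoly\<close>.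
\<close>

primrec weight :: "std_constr \<Rightarrow> (nat \<Rightarrow> nat) \<Rightarrow> label \<Rightarrow> real" where
  "weight Ident f a = 1"
| "weight (Product F G) f a =
    (case a of InLeft b \<Rightarrow> weight F f b | InRight c \<Rightarrow> weight G f c | _ \<Rightarrow> 1)"
| "weight (Tensor F G) f a = (case a of LPair b c \<Rightarrow> weight F f b * weight G f c | _ \<Rightarrow> 1)"
| "weight (SymPower k F) f a = (case a of Mset M \<Rightarrow> (\<Prod>b\<in>#M. weight F f b) | _ \<Rightarrow> 1)"
| "weight (HomPoly k F) f a =
    (case a of
       Mset M \<Rightarrow> mset_fact (image_mset (relabel f) M) / mset_fact M * (\<Prod>b\<in>#M. weight F f b)
     | _ \<Rightarrow> 1)"

text \<open>The coordinate form that \<open>fmap\<close> turns out to have. The cut-off keeps values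
  in \<open>space_of F m\<close>. The source dimension is no parameter, because elements of
  \<open>space_of F n\<close> already vanish at labels outside \<open>basis F n\<close>.\<close>

definition pull :: "std_constr \<Rightarrow> nat \<Rightarrow> (nat \<Rightarrow> nat) \<Rightarrow> vec \<Rightarrow> vec" where
  "pull F m f x = (\<lambda>b. if b \<in> basis F m then weight F f b * x (relabel f b) else 0)"

lemma relabel_ident [simp]: "relabel (\<lambda>i. i) = (\<lambda>a. a)"
proof
  show "relabel (\<lambda>i. i) a = a" for a
    by (induction a) (auto cong: image_mset_cong)
qed

lemma relabel_comp: "relabel g (relabel f a) = relabel (\<lambda>i. g (f i)) a"
  by (induction a) (auto simp: image_mset.compositionality o_def intro!: image_mset_cong)

lemma mset_fact_nonzero [simp]: "mset_fact M \<noteq> 0"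
  by (simp add: mset_fact_def)

lemma mset_fact_empty [simp]: "mset_fact {#} = 1"
  by (simp add: mset_fact_def)

lemma mset_fact_add: "mset_fact (add_mset a M) = real (count M a + 1) * mset_fact M"
proof -
  define P where "P = (\<Prod>b\<in>set_mset M - {a}. fact (count M b) :: real)"
  have "mset_fact (add_mset a M) = (\<Prod>b\<in>insert a (set_mset M - {a}). fact (count (add_mset a M) b))"
    unfolding mset_fact_def by (intro prod.cong) auto
  also have "\<dots> = fact (count M a + 1) * (\<Prod>b\<in>set_mset M - {a}. fact (count (add_mset a M) b))"
    by (subst prod.insert) auto
  also have "(\<Prod>b\<in>set_mset M - {a}. fact (count (add_mset a M) b)) = P"
    unfolding P_def by (rule prod.cong) auto
  finally have 1: "mset_fact (add_mset a M) = fact (count M a + 1) * P" .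
  have "mset_fact M = fact (count M a) * P"
  proof (cases "a \<in># M")
    case True
    then show ?thesis
      unfolding mset_fact_def P_def by (subst prod.remove[of _ a]) auto
  next
    case False
    then show ?thesis
      by (simp add: mset_fact_def P_def not_in_iff)
  qed
  with 1 show ?thesis
    by (simp add: algebra_simps)
qed

lemma weight_ident [simp]: "weight F (\<lambda>i. i) = (\<lambda>_. 1)"
  by (induction F; rule ext) (auto split: label.splits)

text \<open>In the case \<open>HomPoly\<close> the quotients telescope: the nonzero value of
  \<open>mset_fact\<close> at the intermediate multiset \<open>image_mset (relabel f) M\<close>
  cancels.\<close>

lemma weight_comp:
  "weight F (\<lambda>i. g (f i)) = (\<lambda>a. weight F f a * weight F g (relabel f a))"
  by (induction F; rule ext)
    (auto split: label.splits simp: relabel_comp image_mset.compositionality o_def prod_mset.distrib)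

lemma finite_multisets_of_card: "finite B \<Longrightarrow> finite {M. set_mset M \<subseteq> B \<and> size M = k}"
  using finite_multisets_of_size[of B k] by (simp add: multisets_of_size_def)

lemma finite_basis [simp]: "finite (basis F n)"
  by (induction F) (auto intro: finite_multisets_of_card)

lemma prod_mset_image_pos:
  fixes f :: "'a \<Rightarrow> real"
  assumes "\<And>a. a \<in># M \<Longrightarrow> f a > 0"
  shows "(\<Prod>a\<in>#M. f a) > 0"
  using assms by (induction M) auto

lemma sqnorm_pos: "a \<in> basis F n \<Longrightarrow> sqnorm F a > 0"
  by (induction F arbitrary: a)
    (auto intro!: mult_pos_pos divide_pos_pos prod_pos prod_mset_image_pos simp: subset_iff)

lemma relabel_basis:
  assumes "f \<in> {1..m} \<rightarrow> {1..n}"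
  shows "a \<in> basis F m \<Longrightarrow> relabel f a \<in> basis F n"
proof (induction F arbitrary: a)
  case Ident
  then show ?case
    using assms by (auto simp: Pi_iff)
qed fastforce+

lemma relabel_cong:
  assumes "\<And>i. i \<in> {1..m} \<Longrightarrow> f i = g i"
  shows "a \<in> basis F m \<Longrightarrow> relabel f a = relabel g a"
  using assms by (induction F arbitrary: a) (auto intro!: image_mset_cong simp: subset_iff)

lemma weight_cong:
  assumes "\<And>i. i \<in> {1..m} \<Longrightarrow> f i = g i"
  shows "a \<in> basis F m \<Longrightarrow> weight F f a = weight F g a"
proof (induction F arbitrary: a)
  case (SymPower k F)
  then show ?case
    by (auto intro!: arg_cong[where f = prod_mset] image_mset_cong simp: subset_iff)
next
  case (HomPoly k F)
  then obtain M where M: "a = Mset M" "set_mset M \<subseteq> basis F m" "size M = k"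
    by auto
  have "image_mset (relabel f) M = image_mset (relabel g) M"
    using M relabel_cong[of m f g _ F] assms by (auto intro!: image_mset_cong)
  moreover have "image_mset (weight F f) M = image_mset (weight F g) M"
    using M HomPoly.IH by (auto intro!: image_mset_cong)
  ultimately show ?case
    using M by simp
qed auto

lemma pull_cong:
  assumes "\<And>i. i \<in> {1..m} \<Longrightarrow> f i = g i"
  shows "pull F m f = pull F m g"
  using relabel_cong[of m f g _ F, OF assms] weight_cong[of m f g _ F, OF assms]
  by (auto simp: pull_def fun_eq_iff)

text \<open>The range condition on \<open>f\<close> keeps relabelled labels in
  \<open>basis F n\<close>, where the cut-off of the inner \<open>pull\<close> does nothing.\<close>

lemma pull_comp:
  assumes "f \<in> {1..m} \<rightarrow> {1..n}"
  shows "pull F m f (pull F n g x) = pull F m (\<lambda>i. g (f i)) x"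
  using relabel_basis[OF assms, of _ F]
  by (auto simp: pull_def fun_eq_iff weight_comp relabel_comp)

lemma pull_in_space [simp]: "pull F m f x \<in> space_of F m"
  by (simp add: pull_def space_of_def)

lemma pull_unit_vec:
  "pull F m f (unit_vec a) b = (if b \<in> basis F m \<and> relabel f b = a then weight F f b else 0)"
  by (simp add: pull_def unit_vec_def)

lemma unit_vec_in_space: "a \<in> basis F n \<Longrightarrow> unit_vec a \<in> space_of F n"
  by (auto simp: space_of_def unit_vec_def)

section \<open>Adjoints and polynomial functions\<close>

lemma ip_unit_vec: "a \<in> basis F n \<Longrightarrow> ip F n x (unit_vec a) = sqnorm F a * x a"
  by (simp add: ip_def unit_vec_def if_distrib cong: if_cong)

text \<open>Testing against unit vectors recovers each coordinate of the adjoint up to the positive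
  factor \<open>sqnorm F a\<close>; hence the description in \<open>adj\<close> has at most one
  solution.\<close>

lemma adjI:
  assumes z: "z \<in> space_of F n" and eq: "\<And>x. x \<in> space_of F n \<Longrightarrow> ip F m (L x) y = ip F n x z"
  shows "adj F n m L y = z"
  unfolding adj_def
proof (rule the_equality)
  fix z' assume z': "z' \<in> space_of F n \<and> (\<forall>x\<in>space_of F n. ip F m (L x) y = ip F n x z')"
  show "z' = z"
  proof
    fix a
    show "z' a = z a"
    proof (cases "a \<in> basis F n")
      case True
      then have u: "unit_vec a \<in> space_of F n"
        by (rule unit_vec_in_space)
      have "ip F n z' (unit_vec a) = ip F n z (unit_vec a)"
        using eq[OF u] z' u by (simp add: ip_def mult_ac)
      then show ?thesis
        using True sqnorm_pos[OF True] by (simp add: ip_unit_vec)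
    next
      case False
      then show ?thesis
        using z z' by (simp add: space_of_def)
    qed
  qed
qed (use z eq in auto)

text \<open>The adjoint of a pullback sums over the fibres of the label map. Pairing with a basis
  vector instead of reading off a coordinate removes the division by \<open>sqnorm F a\<close>, and
  this pairing is what enters the monomials.\<close>

lemma adj_pull:
  assumes L: "\<And>x. x \<in> space_of F n \<Longrightarrow> L x = pull F m f x"
  shows "a \<in> basis F n \<Longrightarrow> ip F n (adj F n m L y) (unit_vec a) =
    (\<Sum>b\<in>{b \<in> basis F m. relabel f b = a}. weight F f b * (sqnorm F b * y b))"
proof -
  define c where "c a = (\<Sum>b\<in>{b \<in> basis F m. relabel f b = a}. weight F f b * (sqnorm F b * y b))" for a
  define z where "z = (\<lambda>a. if a \<in> basis F n then c a / sqnorm F a else 0)"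
  have "adj F n m L y = z"
  proof (rule adjI)
    fix x assume x: "x \<in> space_of F n"
    have "ip F m (L x) y = (\<Sum>b\<in>basis F m. x (relabel f b) * (weight F f b * (sqnorm F b * y b)))"
      by (simp add: L[OF x] ip_def pull_def mult_ac)
    \<comment> \<open>Sorting by \<open>a = relabel f b\<close> loses nothing when
      \<open>relabel f b\<close> lies outside \<open>basis F n\<close>, because \<open>x\<close> is
      zero there.\<close>
    also have "\<dots> = (\<Sum>b\<in>basis F m. \<Sum>a\<in>basis F n. if relabel f b = a then x a * (weight F f b * (sqnorm F b * y b)) else 0)"
      using x by (intro sum.cong) (auto simp: space_of_def)
    also have "\<dots> = (\<Sum>a\<in>basis F n. x a * c a)"
      unfolding c_def sum_distrib_left
      by (subst sum.swap) (auto simp: sum.inter_filter intro!: sum.cong)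
    also have "\<dots> = ip F n x z"
      unfolding ip_def z_def using sqnorm_pos[of _ F n] by (intro sum.cong) fastforce+
    finally show "ip F m (L x) y = ip F n x z" .
  qed (simp add: z_def space_of_def)
  moreover assume a: "a \<in> basis F n"
  ultimately show ?thesis
    using sqnorm_pos[OF a] by (simp add: ip_unit_vec z_def c_def)
qed

text \<open>
  Induction on the variables: for fixed values of the others, the sum is a polynomial in the variable
  \<open>a\<close>, each of whose coefficients must vanish.
\<close>

lemma monomials_independent:
  fixes d :: "'a multiset \<Rightarrow> real"
  assumes "finite B" "finite S" "\<And>M. M \<in> S \<Longrightarrow> set_mset M \<subseteq> B"
    and "\<And>z. (\<Sum>M\<in>S. d M * (\<Prod>a\<in>#M. z a)) = 0" and "M \<in> S"
  shows "d M = 0"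
  using assms
proof (induction B arbitrary: S d M rule: finite_induct)
  case empty
  then have "S = {{#}}"
    by fastforce
  with empty show ?case
    by simp
next
  case (insert a B)
  define rest where "rest = filter_mset (\<lambda>b. b \<noteq> a)"
  define j where "j = count M a"
  define K where "K = Max ((\<lambda>N. count N a) ` S)"
  define S' where "S' = {N \<in> S. count N a = j}"
  have split: "N = rest N + replicate_mset (count N a) a" for N
    unfolding rest_def by (rule multiset_eqI) auto
  have fin: "finite S'"
    using insert.prems by (simp add: S'_def)
  \<comment> \<open>Within \<open>S'\<close> the exponent of \<open>a\<close> is fixed, so stripping
    \<open>a\<close> from a multiset can be undone.\<close>
  have inj: "inj_on rest S'"
    by (rule inj_on_inverseI[where g = "\<lambda>N. N + replicate_mset j a"])
      (use split in \<open>auto simp: S'_def\<close>)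
  have coeff: "(\<Sum>N\<in>S'. d N * (\<Prod>b\<in>#rest N. z b)) = 0" for z
  proof -
    define c where "c i = (\<Sum>N\<in>{N \<in> S. count N a = i}. d N * (\<Prod>b\<in>#rest N. z b))" for i
    have "(\<Sum>i\<le>K. c i * t ^ i) = 0" for t
    proof -
      have prod: "(\<Prod>b\<in>#N. (z(a := t)) b) = t ^ count N a * (\<Prod>b\<in>#rest N. z b)" for N
      proof -
        have "image_mset (z(a := t)) (rest N) = image_mset z (rest N)"
          by (rule image_mset_cong) (auto simp: rest_def)
        then show ?thesis
          by (subst split) (simp add: mult.commute)
      qed
      have "(\<Sum>i\<le>K. c i * t ^ i) =
          (\<Sum>i\<le>K. \<Sum>N\<in>{N \<in> S. count N a = i}. d N * (\<Prod>b\<in>#N. (z(a := t)) b))"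
        unfolding c_def sum_distrib_right
        by (intro sum.cong refl) (auto simp: prod mult_ac simp del: fun_upd_apply)
      also have "\<dots> = (\<Sum>N\<in>S. d N * (\<Prod>b\<in>#N. (z(a := t)) b))"
        by (rule sum.group) (use insert.prems(1) in \<open>auto simp: K_def\<close>)
      finally show ?thesis
        using insert.prems(3) by simp
    qed
    then have "\<forall>i\<le>K. c i = 0"
      using polyfun_eq_0[of c K] by blast
    moreover have "j \<le> K"
      using insert.prems(1,4) by (auto simp: K_def j_def)
    ultimately show ?thesis
      by (simp add: c_def S'_def)
  qed
  have "d (rest M + replicate_mset j a) = 0"
  proof (rule insert.IH[where S = "rest ` S'" and M = "rest M" and d = "\<lambda>N. d (N + replicate_mset j a)"])
    show "set_mset N \<subseteq> B" if "N \<in> rest ` S'" for N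
      using that insert.prems(2) by (fastforce simp: S'_def rest_def)
    have "d (rest N + replicate_mset j a) = d N" if "N \<in> S'" for N
      using that split[of N] by (simp add: S'_def)
    then show "(\<Sum>N\<in>rest ` S'. d (N + replicate_mset j a) * (\<Prod>b\<in>#N. z b)) = 0" for z
      using coeff[of z] by (subst sum.reindex[OF inj]) simp
    show "rest M \<in> rest ` S'"
      using insert.prems(4) by (auto simp: S'_def j_def)
  qed (use fin in auto)
  then show ?case
    using split[of M] by (simp add: j_def)
qed

text \<open>The multinomial theorem applied to all fibres of \<open>g\<close> at once. One more copy
  of \<open>a\<close> in \<open>M\<close> multiplies by one more sum over the fibre of
  \<open>a\<close>, and each resulting \<open>N\<close> is reached once for every distinct element
  of \<open>N\<close> in that fibre.\<close>

lemma prod_mset_fibre_expansion: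
  fixes z :: "'a \<Rightarrow> real"
  assumes B: "finite B"
  shows "(\<Prod>a\<in>#M. \<Sum>b\<in>{b \<in> B. g b = a}. z b) =
    (\<Sum>N\<in>{N. set_mset N \<subseteq> B \<and> image_mset g N = M}. mset_fact M / mset_fact N * (\<Prod>b\<in>#N. z b))"
proof (induction M)
  case empty
  have "{N. set_mset N \<subseteq> B \<and> image_mset g N = {#}} = {{#}}"
    by auto
  then show ?case
    by simp
next
  case (add a M)
  define T where "T M = {N. set_mset N \<subseteq> B \<and> image_mset g N = M}" for M
  define fib where "fib = {b \<in> B. g b = a}"
  have finT: "finite (T M)" for M
    by (rule finite_subset[OF _ finite_multisets_of_card[OF B, of "size M"]]) (auto simp: T_def)
  have "(\<Prod>a\<in>#add_mset a M. \<Sum>b\<in>{b \<in> B. g b = a}. z b) =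
      (\<Sum>b\<in>fib. z b) * (\<Sum>N\<in>T M. mset_fact M / mset_fact N * (\<Prod>b\<in>#N. z b))"
    using add by (simp add: T_def fib_def)
  also have "\<dots> = (\<Sum>(b, N)\<in>fib \<times> T M. mset_fact M / mset_fact N * (\<Prod>b\<in>#add_mset b N. z b))"
    by (simp add: sum_product sum.cartesian_product mult_ac)
  \<comment> \<open>The pair \<open>(b, N)\<close> becomes \<open>(add_mset b N, b)\<close>; the
    factor \<open>count N b\<close> compensates for the growth of \<open>mset_fact\<close> in the
    denominator.\<close>
  also have "\<dots> = (\<Sum>(N, b)\<in>(SIGMA N:T (add_mset a M). fib \<inter> set_mset N).
      mset_fact M * count N b / mset_fact N * (\<Prod>b\<in>#N. z b))"
    by (rule sum.reindex_bij_witness[where i = "\<lambda>(N, b). (b, N - {#b#})"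
          and j = "\<lambda>(b, N). (add_mset b N, b)"])
      (auto simp: T_def fib_def mset_fact_add image_mset_Diff dest: in_diffD)
  also have "\<dots> = (\<Sum>N\<in>T (add_mset a M). \<Sum>b\<in>fib \<inter> set_mset N.
      mset_fact M * count N b / mset_fact N * (\<Prod>b\<in>#N. z b))"
    by (subst sum.Sigma) (auto simp: finT)
  also have "\<dots> = (\<Sum>N\<in>T (add_mset a M).
      mset_fact (add_mset a M) / mset_fact N * (\<Prod>b\<in>#N. z b))"
  proof (rule sum.cong)
    fix N assume N: "N \<in> T (add_mset a M)"
    \<comment> \<open>The multiplicities in \<open>N\<close> over the fibre of \<open>a\<close> add
      up to that of \<open>a\<close> in the image, which is exactly the factor by which
      \<open>mset_fact M\<close> grows.\<close>
    have "(\<Sum>b\<in>fib \<inter> set_mset N. real (count N b)) = real (count (image_mset g N) a)"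
      unfolding count_image_mset of_nat_sum using N by (intro sum.cong) (auto simp: T_def fib_def)
    also have "\<dots> = real (count M a + 1)"
      using N by (simp add: T_def)
    finally have "(\<Sum>b\<in>fib \<inter> set_mset N. mset_fact M * count N b / mset_fact N * (\<Prod>b\<in>#N. z b)) =
        mset_fact M * real (count M a + 1) / mset_fact N * (\<Prod>b\<in>#N. z b)"
      by (simp flip: sum_distrib_left sum_distrib_right sum_divide_distrib)
    then show "(\<Sum>b\<in>fib \<inter> set_mset N. mset_fact M * count N b / mset_fact N * (\<Prod>b\<in>#N. z b)) =
        mset_fact (add_mset a M) / mset_fact N * (\<Prod>b\<in>#N. z b)"
      by (simp add: mset_fact_add mult_ac)
  qed simp
  finally show ?case
    by (simp add: T_def)
qed

section \<open>The operations on spaces applied to weighted pullbacks\<close>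

lemma tensor_map_pull:
  assumes L: "\<And>x. x \<in> space_of F n \<Longrightarrow> L x = pull F m f x"
    and K: "\<And>x. x \<in> space_of G n \<Longrightarrow> K x = pull G m f x"
    and t: "t \<in> space_of (Tensor F G) n"
  shows "tensor_map (basis F n) (basis G n) L K t = pull (Tensor F G) m f t"
proof
  fix c
  show "tensor_map (basis F n) (basis G n) L K t c = pull (Tensor F G) m f t c"
  proof (cases "\<exists>a' b'. c = LPair a' b'")
    case True
    then obtain a' b' where c: "c = LPair a' b'"
      by blast
    define w where "w = (if a' \<in> basis F m \<and> b' \<in> basis G m then weight F f a' * weight G f b' else 0)"
    have "tensor_map (basis F n) (basis G n) L K t c =
      (\<Sum>a\<in>basis F n. \<Sum>b\<in>basis G n. t (LPair a b) * (pull F m f (unit_vec a) a' * pull G m f (unit_vec b) b'))"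
      using L K by (auto simp: c tensor_map_def unit_vec_in_space intro!: sum.cong)
    also have "\<dots> = (\<Sum>a\<in>basis F n. \<Sum>b\<in>basis G n.
        if relabel f b' = b then (if relabel f a' = a then t (LPair a b) * w else 0) else 0)"
      by (intro sum.cong) (auto simp: pull_unit_vec w_def)
    \<comment> \<open>The guards leave a single term; if a relabelled label leaves its basis, both
      sides are zero since \<open>t\<close> vanishes there.\<close>
    also have "\<dots> = t (LPair (relabel f a') (relabel f b')) * w"
      using t by (cases "relabel f a' \<in> basis F n"; cases "relabel f b' \<in> basis G n")
        (auto simp: space_of_def image_iff)
    finally show ?thesis
      by (auto simp: c w_def pull_def)
  next
    case False
    then show ?thesis
      by (cases c) (auto simp: tensor_map_def pull_def)
  qed
qed

lemma space_of_Mset_zero: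
  assumes "x \<in> space_of (SymPower k F) n \<or> x \<in> space_of (HomPoly k F) n"
    and "\<not> (set_mset M \<subseteq> basis F n \<and> size M = k)"
  shows "x (Mset M) = 0"
  using assms by (auto simp: space_of_def)

text \<open>On words of labels, \<open>L\<^sup>\<otimes>\<^sup>k\<close> is again a pullback: the
  coefficient at \<open>bs\<close> comes from the single word \<open>map (relabel f) bs\<close>. A
  symmetric tensor sees only the multiset of a word, and every multiset of size \<open>k\<close> is
  listed by some word, which gives uniqueness.\<close>

lemma sym_power_pull:
  assumes L: "\<And>x. x \<in> space_of F n \<Longrightarrow> L x = pull F m f x"
    and x: "x \<in> space_of (SymPower k F) n"
  shows "(THE y. y \<in> space_of (SymPower k F) m \<and>
      sym_tensor k y = tensor_power (basis F n) k L (sym_tensor k x)) = pull (SymPower k F) m f x"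
proof (rule the_equality)
  have "tensor_power (basis F n) k L (sym_tensor k x) bs = sym_tensor k (pull (SymPower k F) m f x) bs" for bs
  proof (cases "length bs = k")
    case len: True
    define A where "A = {as. set as \<subseteq> basis F n \<and> length as = k}"
    define w where "w = (if set bs \<subseteq> basis F m then (\<Prod>b\<in>#mset bs. weight F f b) else 0)"
    have finA: "finite A"
      unfolding A_def by (rule finite_lists_length_eq) simp
    have prod: "(\<Prod>i<k. L (unit_vec (as ! i)) (bs ! i)) = (if map (relabel f) bs = as then w else 0)"
      if "as \<in> A" for as
    proof -
      have as: "set as \<subseteq> basis F n" "length as = k"
        using that by (auto simp: A_def)
      have "(\<Prod>i<k. L (unit_vec (as ! i)) (bs ! i)) = (\<Prod>i<k. pull F m f (unit_vec (as ! i)) (bs ! i))"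
        using as L by (intro prod.cong) (auto simp: unit_vec_in_space subset_iff)
      also have "\<dots> = (if map (relabel f) bs = as then w else 0)"
      proof (cases "set bs \<subseteq> basis F m \<and> map (relabel f) bs = as")
        case True
        then have "(\<Prod>i<k. pull F m f (unit_vec (as ! i)) (bs ! i)) = (\<Prod>i<k. weight F f (bs ! i))"
          using len by (intro prod.cong) (auto simp: pull_unit_vec subset_iff)
        also have "\<dots> = prod_list (map (weight F f) bs)"
          using len by (simp add: prod.list_conv_set_nth atLeast0LessThan)
        also have "\<dots> = w"
          using True by (simp add: w_def prod_mset_prod_list flip: mset_map)
        finally show ?thesis
          using True by simp
      next
        case False
        then obtain i where i: "i < k" "bs ! i \<notin> basis F m \<or> relabel f (bs ! i) \<noteq> as ! i"
          using len as by (auto simp: subset_iff in_set_conv_nth list_eq_iff_nth_eq)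
        then have "(\<Prod>i<k. pull F m f (unit_vec (as ! i)) (bs ! i)) = 0"
          by (intro prod_zero) (auto simp: pull_unit_vec)
        then show ?thesis
          using False by (auto simp: w_def)
      qed
      finally show ?thesis .
    qed
    have "tensor_power (basis F n) k L (sym_tensor k x) bs =
        (\<Sum>as\<in>A. sym_tensor k x as * (\<Prod>i<k. L (unit_vec (as ! i)) (bs ! i)))"
      using len by (simp add: tensor_power_def A_def)
    also have "\<dots> = (\<Sum>as\<in>A. if map (relabel f) bs = as then sym_tensor k x as * w else 0)"
      by (intro sum.cong) (auto simp: prod)
    also have "\<dots> = (if map (relabel f) bs \<in> A then sym_tensor k x (map (relabel f) bs) * w else 0)"
      using finA by simp
    also have "\<dots> = x (Mset (image_mset (relabel f) (mset bs))) * w"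
      using space_of_Mset_zero[of x k F n "image_mset (relabel f) (mset bs)"] x len
      by (auto simp: A_def sym_tensor_def)
    also have "\<dots> = sym_tensor k (pull (SymPower k F) m f x) bs"
      using len by (auto simp: sym_tensor_def pull_def w_def)
    finally show ?thesis .
  qed (simp add: tensor_power_def sym_tensor_def)
  then show *: "pull (SymPower k F) m f x \<in> space_of (SymPower k F) m \<and>
      sym_tensor k (pull (SymPower k F) m f x) = tensor_power (basis F n) k L (sym_tensor k x)"
    by (simp add: fun_eq_iff)
  fix y assume "y \<in> space_of (SymPower k F) m \<and>
      sym_tensor k y = tensor_power (basis F n) k L (sym_tensor k x)"
  with * have y: "y \<in> space_of (SymPower k F) m"
    and eq: "sym_tensor k y = sym_tensor k (pull (SymPower k F) m f x)"
    by auto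
  show "y = pull (SymPower k F) m f x"
  proof
    fix c
    show "y c = pull (SymPower k F) m f x c"
    proof (cases "c \<in> basis (SymPower k F) m")
      case True
      then obtain bs where "c = Mset (mset bs)" "length bs = k"
        by (auto, metis ex_mset size_mset)
      then show ?thesis
        using fun_cong[OF eq, of bs] by (simp add: sym_tensor_def)
    next
      case False
      then show ?thesis
        using y by (simp add: space_of_def pull_def)
    qed
  qed
qed

lemma poly_fun_eq:
  "poly_fun F n k c y = (\<Sum>M\<in>{M. set_mset M \<subseteq> basis F n \<and> size M = k}.
     c (Mset M) * (\<Prod>a\<in>#M. sqnorm F a * y a))"
  unfolding poly_fun_def
  by (intro sum.cong arg_cong2[where f = "(*)"] arg_cong[where f = prod_mset] image_mset_cong)
    (auto simp: ip_unit_vec subset_iff)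

lemma poly_fun_inject:
  assumes d: "d \<in> space_of (HomPoly k F) m" "d' \<in> space_of (HomPoly k F) m"
    and eq: "\<And>y. y \<in> space_of F m \<Longrightarrow> poly_fun F m k d y = poly_fun F m k d' y"
  shows "d = d'"
proof
  fix c
  define S where "S = {M. set_mset M \<subseteq> basis F m \<and> size M = k}"
  show "d c = d' c"
  proof (cases "c \<in> basis (HomPoly k F) m")
    case True
    then obtain M where M: "c = Mset M" "M \<in> S"
      by (auto simp: S_def)
    have "d (Mset M) - d' (Mset M) = 0"
    proof (rule monomials_independent[where S = S and B = "basis F m" and M = M
          and d = "\<lambda>M. d (Mset M) - d' (Mset M)"])
      fix z :: "label \<Rightarrow> real"
      \<comment> \<open>Dividing by the squared norms makes the pairings of \<open>y\<close> with
        the basis vectors equal to the arbitrary values \<open>z a\<close>.\<close>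
      define y where "y = (\<lambda>a. if a \<in> basis F m then z a / sqnorm F a else 0)"
      have "y \<in> space_of F m"
        by (simp add: y_def space_of_def)
      then have "(\<Sum>M\<in>S. (d (Mset M) - d' (Mset M)) * (\<Prod>a\<in>#M. sqnorm F a * y a)) = 0"
        using eq[of y] by (simp add: poly_fun_eq S_def left_diff_distrib sum_subtractf)
      moreover have "(\<Prod>a\<in>#M. sqnorm F a * y a) = (\<Prod>a\<in>#M. z a)" if "M \<in> S" for M
        using that sqnorm_pos[of _ F m]
        by (intro arg_cong[where f = prod_mset] image_mset_cong) (force simp: S_def y_def subset_iff)
      ultimately show "(\<Sum>M\<in>S. (d (Mset M) - d' (Mset M)) * (\<Prod>a\<in>#M. z a)) = 0"
        by simp
    qed (use M in \<open>auto simp: S_def intro: finite_multisets_of_card\<close>)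
    then show ?thesis
      by (simp add: M)
  next
    case False
    then show ?thesis
      using d by (simp add: space_of_def)
  qed
qed

text \<open>Under the adjoint, each linear factor of a monomial becomes a sum over a fibre of
  labels. Expanding the product yields the quotients of \<open>mset_fact\<close> that occur in
  \<open>weight\<close>.\<close>

lemma hom_poly_pull:
  assumes L: "\<And>x. x \<in> space_of F n \<Longrightarrow> L x = pull F m f x"
    and c: "c \<in> space_of (HomPoly k F) n"
  shows "(THE d. d \<in> space_of (HomPoly k F) m \<and>
      (\<forall>y\<in>space_of F m. poly_fun F m k d y = poly_fun F n k c (adj F n m L y))) =
    pull (HomPoly k F) m f c"
proof (rule the_equality)
  define S where "S n = {M. set_mset M \<subseteq> basis F n \<and> size M = k}" for n
  define T where "T M = {N. set_mset N \<subseteq> basis F m \<and> image_mset (relabel f) N = M}" for M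
  have finS: "finite (S n)" for n
    unfolding S_def by (rule finite_multisets_of_card) simp
  have finT: "finite (T M)" for M
    by (rule finite_subset[OF _ finite_multisets_of_card[OF finite_basis, of F m "size M"]]) (auto simp: T_def)
  have "poly_fun F m k (pull (HomPoly k F) m f c) y = poly_fun F n k c (adj F n m L y)" for y
  proof -
    define z where "z b = weight F f b * (sqnorm F b * y b)" for b
    define t where "t N = c (Mset (image_mset (relabel f) N)) *
      (mset_fact (image_mset (relabel f) N) / mset_fact N * (\<Prod>b\<in>#N. z b))" for N
    have "poly_fun F n k c (adj F n m L y) =
        (\<Sum>M\<in>S n. c (Mset M) * (\<Prod>a\<in>#M. \<Sum>b\<in>{b \<in> basis F m. relabel f b = a}. z b))"
      unfolding poly_fun_def S_def z_def
      by (intro sum.cong arg_cong2[where f = "(*)"] arg_cong[where f = prod_mset] image_mset_cong)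
        (auto simp: adj_pull[OF L] subset_iff)
    also have "\<dots> = (\<Sum>M\<in>S n. \<Sum>N\<in>T M. t N)"
      unfolding prod_mset_fibre_expansion[OF finite_basis] sum_distrib_left T_def
      by (intro sum.cong) (auto simp: t_def)
    \<comment> \<open>A pair of \<open>M\<close> and some \<open>N\<close> lying over it is
      determined by \<open>N\<close> alone.\<close>
    also have "\<dots> = (\<Sum>N\<in>{N \<in> S m. image_mset (relabel f) N \<in> S n}. t N)"
      by (subst sum.Sigma, use finS finT in simp, use finT in simp,
          rule sum.reindex_bij_witness[where i = "\<lambda>N. (image_mset (relabel f) N, N)" and j = snd])
        (auto simp: S_def T_def)
    \<comment> \<open>Multisets \<open>N\<close> whose image leaves \<open>S n\<close> may be added,
      because \<open>c\<close> vanishes at that image.\<close>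
    also have "\<dots> = (\<Sum>N\<in>S m. t N)"
    proof (rule sum.mono_neutral_left)
      show "\<forall>N\<in>S m - {N \<in> S m. image_mset (relabel f) N \<in> S n}. t N = 0"
        using c by (auto simp: t_def S_def intro!: space_of_Mset_zero)
    qed (use finS in auto)
    also have "\<dots> = poly_fun F m k (pull (HomPoly k F) m f c) y"
      unfolding poly_fun_eq S_def
      by (intro sum.cong) (auto simp: t_def z_def pull_def prod_mset.distrib)
    finally show ?thesis ..
  qed
  then show *: "pull (HomPoly k F) m f c \<in> space_of (HomPoly k F) m \<and> (\<forall>y\<in>space_of F m.
      poly_fun F m k (pull (HomPoly k F) m f c) y = poly_fun F n k c (adj F n m L y))"
    by simp
  fix d assume "d \<in> space_of (HomPoly k F) m \<and>
      (\<forall>y\<in>space_of F m. poly_fun F m k d y = poly_fun F n k c (adj F n m L y))"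
  with * show "d = pull (HomPoly k F) m f c"
    by (intro poly_fun_inject) auto
qed

text \<open>Agreement of \<open>A\<close> with \<open>pullback m f\<close> is asked only for vectors
  supported on \<open>{1..n}\<close>, since zero-padding and permutations in general coincide with a
  pullback only on those.\<close>

lemma fmap_pull:
  assumes A: "\<And>x. (\<And>i. i \<notin> {1..n} \<Longrightarrow> x i = 0) \<Longrightarrow> A x = pullback m f x"
  shows "x \<in> space_of F n \<Longrightarrow> fmap F n m A x = pull F m f x"
proof (induction F arbitrary: x)
  case Ident
  then have "A (\<lambda>j. x (Coord j)) = pullback m f (\<lambda>j. x (Coord j))"
    by (intro A) (auto simp: space_of_def image_iff)
  then show ?case
    by (auto simp: fun_eq_iff pull_def pullback_def split: label.splits)
next
  case (Product F G)
  have "(\<lambda>b. x (InLeft b)) \<in> space_of F n" "(\<lambda>b. x (InRight b)) \<in> space_of G n"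
    using Product.prems by (auto simp: space_of_def)
  then show ?case
    using Product.IH by (auto simp: fun_eq_iff pull_def split: label.splits)
next
  case (Tensor F G)
  then show ?case
    by (simp add: tensor_map_pull)
next
  case (SymPower k F)
  show ?case
    using sym_power_pull[OF SymPower.IH SymPower.prems] by simp
next
  case (HomPoly k F)
  show ?case
    using hom_poly_pull[OF HomPoly.IH HomPoly.prems] by simp
qed

section \<open>The maps of both sequences as weighted pullbacks\<close>

lemma act_eq_pull:
  assumes "\<sigma> \<in> perms n" "x \<in> space_of F n"
  shows "act F n \<sigma> x = pull F n (inv \<sigma>) x"
  unfolding act_def
proof (rule fmap_pull[OF _ assms(2)])
  fix x :: "nat \<Rightarrow> real" assume x: "x i = 0" if "i \<notin> {1..n}" for i
  have "inv \<sigma> i = i" if "i \<notin> {1..n}" for i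
    using assms(1) that by (auto simp: perms_def intro: permutes_not_in permutes_inv)
  then show "perm_map \<sigma> x = pullback n (inv \<sigma>) x"
    using x by (auto simp: perm_map_def pullback_def)
qed

lemma rho_eq_pull: "x \<in> space_of F n \<Longrightarrow> rho F n m f x = pull F m f x"
  unfolding rho_def by (rule fmap_pull) auto

lemma psi_eq_pull:
  "x \<in> space_of F n \<Longrightarrow> psi F N n x = pull F N (\<lambda>i. (i - 1) div (N div n) + 1) x"
  unfolding psi_def by (rule fmap_pull) (auto simp: duplicate_def pullback_def)

lemma phi_eq_pull:
  assumes "n \<le> N" "x \<in> space_of F n"
  shows "phi F N n x = pull F N (\<lambda>i. i) x"
  unfolding phi_def by (rule fmap_pull[OF _ assms(2)])
    (use assms(1) in \<open>auto simp: zero_pad_def pullback_def\<close>)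

text \<open>\<open>basis F n\<close> is a subset of \<open>basis F N\<close> with the same squared
  norms, and an inclusion has weights 1, so the adjoint of zero-padding restricts
  coordinates.\<close>

lemma phi_adj_eq_pull:
  assumes "n \<le> N"
  shows "phi_adj F N n y = pull F n (\<lambda>i. i) y"
  unfolding phi_adj_def
proof (rule adjI)
  have mono: "basis F n \<subseteq> basis F N"
    using relabel_basis[of "\<lambda>i. i" n N _ F] assms by auto
  fix x assume x: "x \<in> space_of F n"
  have "ip F N (phi F N n x) y = (\<Sum>a\<in>basis F N. sqnorm F a * x a * y a)"
    by (simp add: phi_eq_pull[OF assms x] ip_def pull_def)
  also have "\<dots> = (\<Sum>a\<in>basis F n. sqnorm F a * x a * y a)"
    using x mono by (intro sum.mono_neutral_right) (auto simp: space_of_def)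
  finally show "ip F N (phi F N n x) y = ip F n x (pull F n (\<lambda>i. i) y)"
    by (simp add: ip_def pull_def)
qed simp

text \<open>Each coordinate of \<open>pull F m f x\<close> is zero or a multiple of one coordinate
  of \<open>x\<close>, hence continuous in the product topology.\<close>

lemma pull_measurable: "pull F m f \<in> borel_measurable borel"
proof (rule borel_measurable_continuous_onI)
  show "continuous_on UNIV (pull F m f)"
  proof (rule continuous_on_coordinatewise_then_product)
    show "continuous_on UNIV (\<lambda>x. pull F m f x b)" for b
      by (cases "b \<in> basis F m")
        (simp_all add: pull_def continuous_on_mult_left continuous_on_product_coordinates)
  qed
qed

section \<open>Averages over finite sets and mixtures\<close>

text \<open>The complements of \<open>A\<close> and of its injective image in \<open>B\<close> have
  equal size, and any bijection between them completes \<open>f\<close>.\<close>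

lemma extend_injection_to_permutation:
  assumes "finite B" "A \<subseteq> B" "f ` A \<subseteq> B" "inj_on f A"
  shows "\<exists>p. p permutes B \<and> (\<forall>x\<in>A. p x = f x)"
proof -
  have "card (B - A) = card (B - f ` A)"
    using assms by (simp add: card_Diff_subset finite_subset card_image)
  then obtain g where g: "bij_betw g (B - A) (B - f ` A)"
    using assms(1) finite_same_card_bij[of "B - A" "B - f ` A"] by auto
  define p where "p x = (if x \<in> A then f x else if x \<in> B then g x else x)" for x
  have "bij_betw p (A \<union> (B - A)) (f ` A \<union> (B - f ` A))"
  proof (rule bij_betw_combine)
    show "bij_betw p A (f ` A)"
      using assms(4) by (auto simp: bij_betw_def p_def inj_on_def image_def)
    show "bij_betw p (B - A) (B - f ` A)"
      using g by (rule bij_betw_cong[THEN iffD1, rotated]) (auto simp: p_def)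
  qed auto
  moreover have "A \<union> (B - A) = B" "f ` A \<union> (B - f ` A) = B"
    using assms by auto
  ultimately have "p permutes B"
    using assms(2) by (intro bij_imp_permutes) (auto simp: p_def)
  then show ?thesis
    by (auto simp: p_def)
qed

text \<open>Grouping by the value of \<open>h\<close> produces \<open>c\<close> copies of each term;
  the constant function 1 then gives \<open>card S = c * card T\<close>. In probabilistic terms,
  \<open>h\<close> carries the uniform distribution to the uniform distribution.\<close>

lemma average_equal_fibres:
  fixes G :: "'b \<Rightarrow> real"
  assumes "finite S" "finite T" "h ` S \<subseteq> T" "c > 0"
    and fibres: "\<And>t. t \<in> T \<Longrightarrow> card {s \<in> S. h s = t} = c"
  shows "(\<Sum>s\<in>S. G (h s)) / card S = (\<Sum>t\<in>T. G t) / card T"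
proof -
  have avg: "(\<Sum>s\<in>S. H (h s)) = real c * (\<Sum>t\<in>T. H t)" for H :: "'b \<Rightarrow> real"
  proof -
    have "(\<Sum>s\<in>S. H (h s)) = (\<Sum>t\<in>T. \<Sum>s\<in>{s \<in> S. h s = t}. H (h s))"
      using sum.group[OF assms(1-3), of "\<lambda>s. H (h s)"] by simp
    also have "\<dots> = (\<Sum>t\<in>T. real c * H t)"
      by (intro sum.cong refl) (simp add: fibres)
    finally show ?thesis
      by (simp add: sum_distrib_left)
  qed
  show ?thesis
    using avg[of G] avg[of "\<lambda>_. 1"] assms(4) by simp
qed

lemma prob_space_measure_eqI:
  assumes "prob_space M" "prob_space N" "sets M = sets N"
    and "\<And>A. A \<in> sets M \<Longrightarrow> measure M A = measure N A"
  shows "M = N"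
  using assms by (intro measure_eqI) (auto simp: finite_measure.emeasure_eq_measure prob_space.axioms(1))

section \<open>Laws of \<open>g s X\<close> with \<open>s\<close> uniform on a finite set\<close>

context
  fixes \<mu> :: "'a measure" and S :: "'s set" and K :: "'b measure" and g :: "'s \<Rightarrow> 'a \<Rightarrow> 'b"
  assumes \<mu>: "prob_space \<mu>" and S: "finite S" "S \<noteq> {}"
    and g: "\<And>s. s \<in> S \<Longrightarrow> g s \<in> measurable \<mu> K"
begin

lemma uniform_mixture_measurable:
  "(\<lambda>(x, s). g s x) \<in> measurable (\<mu> \<Otimes>\<^sub>M uniform_count_measure S) K"
proof -
  have "(\<lambda>p. g (snd p) (fst p)) \<in> measurable (\<mu> \<Otimes>\<^sub>M count_space S) K"
  proof (rule measurable_compose_countable'[where f = "\<lambda>s p. g s (fst p)" and g = snd and I = S])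
    show "(\<lambda>p. g s (fst p)) \<in> measurable (\<mu> \<Otimes>\<^sub>M count_space S) K" if "s \<in> S" for s
      by (rule measurable_compose[OF measurable_fst g[OF that]])
  qed (use S in \<open>auto intro: countable_finite\<close>)
  moreover have "sets (\<mu> \<Otimes>\<^sub>M count_space S) = sets (\<mu> \<Otimes>\<^sub>M uniform_count_measure S)"
    by (intro sets_pair_measure_cong) (simp_all only: sets_uniform_count_measure_count_space)
  ultimately show ?thesis
    unfolding case_prod_beta' using measurable_cong_sets by blast
qed

lemma uniform_mixture_prob:
  "prob_space (distr (\<mu> \<Otimes>\<^sub>M uniform_count_measure S) K (\<lambda>(x, s). g s x))"
proof -
  interpret U: prob_space "uniform_count_measure S"
    using S by (rule prob_space_uniform_count_measure)
  interpret \<mu>: prob_space \<mu>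
    by (rule \<mu>)
  interpret P: pair_prob_space \<mu> "uniform_count_measure S" ..
  show ?thesis
    by (rule P.prob_space_distr[OF uniform_mixture_measurable])
qed

text \<open>Fubini, with the integral over the finite index set written as an average; the bound on
  \<open>h\<close> supplies integrability.\<close>

lemma uniform_mixture_integral:
  fixes h :: "'b \<Rightarrow> real"
  assumes h: "h \<in> borel_measurable K" and bound: "\<And>y. y \<in> space K \<Longrightarrow> \<bar>h y\<bar> \<le> B"
  shows "integral\<^sup>L (distr (\<mu> \<Otimes>\<^sub>M uniform_count_measure S) K (\<lambda>(x, s). g s x)) h =
    (\<Sum>s\<in>S. integral\<^sup>L (distr \<mu> K (g s)) h) / card S"
proof -
  interpret U: prob_space "uniform_count_measure S"
    using S by (rule prob_space_uniform_count_measure)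
  interpret \<mu>: prob_space \<mu>
    by (rule \<mu>)
  interpret P: pair_prob_space \<mu> "uniform_count_measure S" ..
  note meas = uniform_mixture_measurable
  have int: "integrable (\<mu> \<Otimes>\<^sub>M uniform_count_measure S) (\<lambda>(x, s). h (g s x))"
  proof (rule P.integrable_const_bound)
    show "(\<lambda>(x, s). h (g s x)) \<in> borel_measurable (\<mu> \<Otimes>\<^sub>M uniform_count_measure S)"
      using measurable_compose[OF meas h] by (simp add: case_prod_beta')
    show "AE p in \<mu> \<Otimes>\<^sub>M uniform_count_measure S. norm (case p of (x, s) \<Rightarrow> h (g s x)) \<le> B"
      using measurable_space[OF meas] bound by (intro AE_I2) (auto simp: case_prod_beta')
  qed
  have "integral\<^sup>L (distr (\<mu> \<Otimes>\<^sub>M uniform_count_measure S) K (\<lambda>(x, s). g s x)) h =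
      integral\<^sup>L (\<mu> \<Otimes>\<^sub>M uniform_count_measure S) (\<lambda>(x, s). h (g s x))"
    by (subst integral_distr[OF meas h]) (simp add: case_prod_beta')
  also have "\<dots> = (\<integral>s. (\<integral>x. h (g s x) \<partial>\<mu>) \<partial>uniform_count_measure S)"
    using P.integral_snd[OF int] by simp
  also have "\<dots> = (\<Sum>s\<in>S. (\<integral>x. h (g s x) \<partial>\<mu>)) / card S"
    using S by (simp add: integral_uniform_count_measure)
  also have "(\<Sum>s\<in>S. (\<integral>x. h (g s x) \<partial>\<mu>)) = (\<Sum>s\<in>S. integral\<^sup>L (distr \<mu> K (g s)) h)"
    by (intro sum.cong refl) (simp add: integral_distr[OF g h])
  finally show ?thesis .
qed

lemma uniform_mixture_measure:
  assumes A: "A \<in> sets K"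
  shows "measure (distr (\<mu> \<Otimes>\<^sub>M uniform_count_measure S) K (\<lambda>(x, s). g s x)) A =
    (\<Sum>s\<in>S. measure (distr \<mu> K (g s)) A) / card S"
proof -
  have *: "A \<inter> space K = A"
    using sets.sets_into_space[OF A] by auto
  have bound: "\<bar>indicator A y :: real\<bar> \<le> 1" for y
    by (simp add: indicator_def)
  show ?thesis
    using uniform_mixture_integral[OF borel_measurable_indicator[OF A] bound] * by simp
qed

end

section \<open>Uniformly random maps between index sets\<close>

abbreviation index_maps :: "nat \<Rightarrow> nat \<Rightarrow> (nat \<Rightarrow> nat) set" where
  "index_maps m n \<equiv> {1..m} \<rightarrow>\<^sub>E {1..n}"

lemma card_index_maps: "card (index_maps m n) = n ^ m"
  by (simp add: card_funcsetE)

lemma finite_index_maps: "finite (index_maps m n)"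
  by (simp add: finite_PiE)

lemma index_maps_imp_Pi: "f \<in> index_maps m n \<Longrightarrow> f \<in> {1..m} \<rightarrow> {1..n}"
  by (rule PiE_mem[THEN Pi_I])

lemma index_maps_nonempty: "1 \<le> n \<Longrightarrow> index_maps m n \<noteq> {}"
  by (simp add: PiE_eq_empty_iff)

text \<open>Prescribing the composite fixes \<open>f\<close> on the \<open>k\<close> points of the
  image of \<open>g\<close> and leaves \<open>m - k\<close> points free.\<close>

lemma card_precompose_fibre:
  assumes g: "inj_on g {1..k}" "g ` {1..k} \<subseteq> {1..m}" and t: "t \<in> index_maps k n"
  shows "card {f \<in> index_maps m n. (\<lambda>i\<in>{1..k}. f (g i)) = t} = n ^ (m - k)"
proof -
  define T where "T j = (if j \<in> g ` {1..k} then {t (inv_into {1..k} g j)} else {1..n})" for j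
  have inv: "inv_into {1..k} g (g i) = i" if "i \<in> {1..k}" for i
    using g(1) that by (rule inv_into_f_f)
  have "{f \<in> index_maps m n. (\<lambda>i\<in>{1..k}. f (g i)) = t} = PiE {1..m} T"
  proof (intro equalityI subsetI)
    fix f assume f: "f \<in> {f \<in> index_maps m n. (\<lambda>i\<in>{1..k}. f (g i)) = t}"
    then have "restrict (\<lambda>i. f (g i)) {1..k} = t"
      by simp
    then have fg: "f (g i) = t i" if "i \<in> {1..k}" for i
      using that by (metis restrict_apply')
    have "f j \<in> T j" if "j \<in> {1..m}" for j
      using f that fg inv by (cases "j \<in> g ` {1..k}") (auto simp: T_def PiE_iff)
    moreover have "f \<in> extensional {1..m}"
      using f by (simp add: PiE_iff)
    ultimately show "f \<in> PiE {1..m} T"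
      by (simp add: PiE_iff)
  next
    fix f assume f: "f \<in> PiE {1..m} T"
    have fg: "f (g i) = t i" if "i \<in> {1..k}" for i
    proof -
      have "g i \<in> {1..m}"
        using g(2) that by blast
      then have "f (g i) \<in> T (g i)"
        by (rule PiE_mem[OF f])
      then show ?thesis
        using imageI[OF that, of g] inv[OF that] by (simp only: T_def if_True singleton_iff)
    qed
    have "f j \<in> {1..n}" if "j \<in> {1..m}" for j
    proof (cases "j \<in> g ` {1..k}")
      case True
      then obtain i where "i \<in> {1..k}" "j = g i"
        by auto
      then show ?thesis
        using fg PiE_mem[OF t] by simp
    next
      case False
      then show ?thesis
        using PiE_mem[OF f that] by (simp only: T_def if_False)
    qed
    moreover have "f \<in> extensional {1..m}"
      using f by (simp add: PiE_iff)
    moreover have "(\<lambda>i\<in>{1..k}. f (g i)) = t"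
      using fg t by (intro extensionalityI[of _ "{1..k}"]) (auto simp: PiE_iff)
    ultimately show "f \<in> {f \<in> index_maps m n. (\<lambda>i\<in>{1..k}. f (g i)) = t}"
      by (simp add: PiE_iff)
  qed
  then have "card {f \<in> index_maps m n. (\<lambda>i\<in>{1..k}. f (g i)) = t} = (\<Prod>j\<in>{1..m}. card (T j))"
    by (simp add: card_PiE)
  also have "\<dots> = (\<Prod>j\<in>{1..m} - g ` {1..k}. n)"
    by (intro prod.mono_neutral_cong_right) (auto simp: T_def)
  also have "\<dots> = n ^ (m - k)"
    using g by (simp add: card_Diff_subset card_image)
  finally show ?thesis .
qed

text \<open>All fibres of precomposition with an injection have \<open>n ^ (m - k)\<close> elements,
  so a uniform map stays uniform.\<close>

lemma average_precompose:
  fixes G :: "(nat \<Rightarrow> nat) \<Rightarrow> real"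
  assumes "1 \<le> n" "inj_on g {1..k}" "g ` {1..k} \<subseteq> {1..m}"
  shows "(\<Sum>f\<in>index_maps m n. G (\<lambda>i\<in>{1..k}. f (g i))) / card (index_maps m n) =
    (\<Sum>f\<in>index_maps k n. G f) / card (index_maps k n)"
proof (rule average_equal_fibres[where c = "n ^ (m - k)"])
  show "(\<lambda>f. \<lambda>i\<in>{1..k}. f (g i)) ` index_maps m n \<subseteq> index_maps k n"
    using assms(3) by (auto simp: PiE_iff image_subset_iff)
  show "card {f \<in> index_maps m n. (\<lambda>i\<in>{1..k}. f (g i)) = t} = n ^ (m - k)" if "t \<in> index_maps k n" for t
    by (rule card_precompose_fibre[OF assms(2,3) that])
qed (use assms(1) in \<open>auto simp: finite_PiE\<close>)

text \<open>The values of \<open>f\<close> are chosen independently, so a fibre of postcomposition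
  is a product of \<open>m\<close> fibres of \<open>e\<close>, with \<open>c ^ m\<close>
  elements.\<close>

lemma average_postcompose:
  fixes G :: "(nat \<Rightarrow> nat) \<Rightarrow> real"
  assumes e: "e ` {1..N} \<subseteq> {1..n}" and "c > 0"
    and fibres: "\<And>t. t \<in> {1..n} \<Longrightarrow> card {j \<in> {1..N}. e j = t} = c"
  shows "(\<Sum>f\<in>index_maps m N. G (\<lambda>i\<in>{1..m}. e (f i))) / card (index_maps m N) =
    (\<Sum>f\<in>index_maps m n. G f) / card (index_maps m n)"
proof (rule average_equal_fibres[where c = "c ^ m"])
  show "(\<lambda>f. \<lambda>i\<in>{1..m}. e (f i)) ` index_maps m N \<subseteq> index_maps m n"
    using e by (auto simp: PiE_iff image_subset_iff)
  fix t assume t: "t \<in> index_maps m n"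
  have "{f \<in> index_maps m N. (\<lambda>i\<in>{1..m}. e (f i)) = t} = (\<Pi>\<^sub>E i\<in>{1..m}. {j \<in> {1..N}. e j = t i})"
  proof (intro equalityI subsetI)
    fix f assume f: "f \<in> {f \<in> index_maps m N. (\<lambda>i\<in>{1..m}. e (f i)) = t}"
    then have "restrict (\<lambda>i. e (f i)) {1..m} = t"
      by simp
    then have "e (f i) = t i" if "i \<in> {1..m}" for i
      using that by (metis restrict_apply')
    with f show "f \<in> (\<Pi>\<^sub>E i\<in>{1..m}. {j \<in> {1..N}. e j = t i})"
      by (simp add: PiE_iff)
  next
    fix f assume f: "f \<in> (\<Pi>\<^sub>E i\<in>{1..m}. {j \<in> {1..N}. e j = t i})"
    have "(\<lambda>i\<in>{1..m}. e (f i)) = t"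
      using f t by (intro extensionalityI[of _ "{1..m}"]) (auto simp: PiE_iff)
    with f show "f \<in> {f \<in> index_maps m N. (\<lambda>i\<in>{1..m}. e (f i)) = t}"
      by (simp add: PiE_iff)
  qed
  then have "card {f \<in> index_maps m N. (\<lambda>i\<in>{1..m}. e (f i)) = t} = (\<Prod>i\<in>{1..m}. card {j \<in> {1..N}. e j = t i})"
    by (simp add: card_PiE)
  also have "\<dots> = (\<Prod>i\<in>{1..m}. c)"
    using t by (intro prod.cong refl fibres) (auto simp: PiE_iff)
  finally show "card {f \<in> index_maps m N. (\<lambda>i\<in>{1..m}. e (f i)) = t} = c ^ m"
    by simp
qed (use assms(2) in \<open>auto simp: finite_PiE\<close>)

lemma duplication_index:
  fixes n N j :: nat
  assumes "n dvd N" "1 \<le> N" "j \<in> {1..N}"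
  shows "(j - 1) div (N div n) + 1 \<in> {1..n}"
proof -
  have n: "n * (N div n) = N"
    using assms(1) by (rule dvd_mult_div_cancel)
  then have "N div n > 0"
    using assms(2) by (metis mult_0_right neq0_conv not_one_le_zero)
  moreover have "j - 1 < n * (N div n)"
    using assms(2,3) n by auto
  ultimately have "(j - 1) div (N div n) < n"
    by (simp add: less_mult_imp_div_less)
  then show ?thesis
    by simp
qed

lemma card_duplication_fibre:
  assumes "n dvd N" "1 \<le> N" "t \<in> {1..n}"
  shows "card {j \<in> {1..N}. (j - 1) div (N div n) + 1 = t} = N div n"
proof -
  define d where "d = N div n"
  have n: "n * d = N"
    unfolding d_def using assms(1) by (rule dvd_mult_div_cancel)
  then have d: "d > 0"
    using assms(2) by (metis mult_0_right neq0_conv not_one_le_zero)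
  \<comment> \<open>The fibre is the \<open>t\<close>-th block of \<open>d\<close> consecutive
    indices, counted from 1.\<close>
  have "{j \<in> {1..N}. (j - 1) div d + 1 = t} = {(t - 1) * d + 1..t * d}"
  proof (intro equalityI subsetI)
    fix j assume j: "j \<in> {j \<in> {1..N}. (j - 1) div d + 1 = t}"
    then have "(j - 1) div d = t - 1"
      by auto
    then have "(t - 1) * d \<le> j - 1" "j - 1 < (t - 1) * d + d"
      using d dividend_less_div_times[of d "j - 1"] times_div_less_eq_dividend[of d "j - 1"]
      by (auto simp: mult.commute)
    moreover have "(t - 1) * d + d = t * d"
      using assms(3) by (cases t) auto
    moreover have "1 \<le> j"
      using j by simp
    ultimately show "j \<in> {(t - 1) * d + 1..t * d}"
      unfolding atLeastAtMost_iff by linarith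
  next
    fix j assume j: "j \<in> {(t - 1) * d + 1..t * d}"
    have td: "(t - 1) * d + d = t * d"
      using assms(3) by (cases t) auto
    have tN: "t * d \<le> N"
      using assms(3) unfolding n[symmetric] by (intro mult_le_mono1) simp
    have "(j - 1) div d = t - 1"
      using j td by (intro div_nat_eqI) (auto simp: mult.commute)
    then show "j \<in> {j \<in> {1..N}. (j - 1) div d + 1 = t}"
      using j tN assms(3) by auto
  qed
  moreover have "t * d - (t - 1) * d = d"
    using assms(3) by (cases t) auto
  ultimately show ?thesis
    by (simp add: d_def)
qed

text \<open>In the induction the cross term \<open>a k * (\<Prod>i<k. 1 - a i)\<close> is at most
  \<open>a k\<close>, because the product is at most 1.\<close>

lemma prod_ge_one_minus_sum:
  fixes a :: "nat \<Rightarrow> real"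
  assumes "\<And>i. i < k \<Longrightarrow> 0 \<le> a i \<and> a i \<le> 1"
  shows "(\<Prod>i<k. 1 - a i) \<ge> 1 - (\<Sum>i<k. a i)"
  using assms
proof (induction k)
  case (Suc k)
  have p: "0 \<le> (\<Prod>i<k. 1 - a i)" "(\<Prod>i<k. 1 - a i) \<le> 1"
    using Suc.prems by (auto intro!: prod_nonneg prod_le_1)
  have "a k * (\<Prod>i<k. 1 - a i) \<le> a k"
    using p Suc.prems[of k] by (simp add: mult_left_le)
  then show ?case
    using Suc by (simp add: algebra_simps)
qed simp

text \<open>The birthday estimate: a random map is injective with probability
  \<open>\<Prod>i<m. 1 - i / n\<close>, which is at least
  \<open>1 - (\<Sum>i<m. i / n)\<close>.\<close>

lemma card_noninjective_index_maps:
  assumes "m \<le> n" "1 \<le> n"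
  shows "real (card {f \<in> index_maps m n. \<not> inj_on f {1..m}}) / card (index_maps m n) \<le>
    real m * (real m - 1) / (2 * real n)"
proof -
  define I where "I = {f \<in> index_maps m n. inj_on f {1..m}}"
  have "real (card I) = (\<Prod>i<m. real n - real i)"
  proof -
    have "card I = (\<Prod>i<m. n - i)"
      using card_inj_on_subset_funcset[of "{1..m}" "{1..n}" "{1..m}"]
      by (simp add: I_def atLeast0LessThan)
    \<comment> \<open>Here \<open>m \<le> n\<close> makes the truncated subtraction exact.\<close>
    also have "real (\<Prod>i<m. n - i) = (\<Prod>i<m. real n - real i)"
      unfolding of_nat_prod using assms(1) by (intro prod.cong) auto
    finally show ?thesis .
  qed
  also have "\<dots> = real n ^ m * (\<Prod>i<m. 1 - real i / real n)"
  proof -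
    have "(\<Prod>i<m. real n - real i) = (\<Prod>i<m. real n * (1 - real i / real n))"
      using assms(2) by (intro prod.cong) (auto simp: right_diff_distrib)
    then show ?thesis
      by (simp add: prod.distrib)
  qed
  also have "\<dots> \<ge> real n ^ m * (1 - (\<Sum>i<m. real i / real n))"
    using assms by (intro mult_left_mono prod_ge_one_minus_sum) auto
  also have "(\<Sum>i<m. real i / real n) = real m * (real m - 1) / (2 * real n)"
  proof -
    have "(\<Sum>i<m. real i) = real m * (real m - 1) / 2"
      by (induction m) (auto simp: field_simps)
    then show ?thesis
      by (simp add: divide_simps flip: sum_divide_distrib)
  qed
  finally have I: "real (card I) \<ge> real n ^ m * (1 - real m * (real m - 1) / (2 * real n))" .
  have "card {f \<in> index_maps m n. \<not> inj_on f {1..m}} + card I = card (index_maps m n)"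
  proof -
    have "index_maps m n = {f \<in> index_maps m n. \<not> inj_on f {1..m}} \<union> I"
      by (auto simp: I_def)
    also have "card \<dots> = card {f \<in> index_maps m n. \<not> inj_on f {1..m}} + card I"
      by (rule card_Un_disjoint) (auto simp: I_def finite_PiE)
    finally show ?thesis ..
  qed
  then have "real (card {f \<in> index_maps m n. \<not> inj_on f {1..m}}) = real n ^ m - real (card I)"
    using card_index_maps[of m n] by (metis add_diff_cancel_right' of_nat_add of_nat_power)
  with I have "real (card {f \<in> index_maps m n. \<not> inj_on f {1..m}}) \<le>
      real n ^ m * (real m * (real m - 1) / (2 * real n))"
    by (simp add: algebra_simps)
  then show ?thesis
    using assms(2) unfolding card_index_maps by (simp add: divide_le_eq mult.commute)
qed

section \<open>Laws of random pullbacks\<close>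

lemma space_borel_on [simp]: "space (borel_on A) = A"
  by (simp add: borel_on_def space_restrict_space)

text \<open>Closure under all maps \<open>\<rho>(f)\<close> replaces the closure hypotheses of the
  theorem. The abstraction covers both the given sets and the full spaces, where the total variation
  bound is claimed.\<close>

locale pull_closed_sets =
  fixes F :: std_constr and \<Omega> :: "nat \<Rightarrow> vec set"
  assumes subset: "1 \<le> n \<Longrightarrow> \<Omega> n \<subseteq> space_of F n"
    and pull_closed: "\<lbrakk>1 \<le> m; 1 \<le> n; f \<in> {1..m} \<rightarrow> {1..n}; x \<in> \<Omega> n\<rbrakk>
      \<Longrightarrow> pull F m f x \<in> \<Omega> m"
begin

definition pull_law :: "nat \<Rightarrow> (nat \<Rightarrow> nat) \<Rightarrow> vec measure \<Rightarrow> vec measure" where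
  "pull_law m f \<mu> = distr \<mu> (borel_on (\<Omega> m)) (pull F m f)"

lemma space_prob_measures: "\<mu> \<in> prob_measures A \<Longrightarrow> space \<mu> = A"
  using sets_eq_imp_space_eq[of \<mu> "borel_on A"] by (simp add: prob_measures_def)

lemma pull_measurable_on:
  assumes "1 \<le> m" "1 \<le> n" "f \<in> {1..m} \<rightarrow> {1..n}" "\<mu> \<in> prob_measures (\<Omega> n)"
  shows "pull F m f \<in> measurable \<mu> (borel_on (\<Omega> m))"
proof -
  have "pull F m f \<in> measurable (borel_on (\<Omega> n)) (borel_on (\<Omega> m))"
    unfolding borel_on_def
    using pull_measurable pull_closed[OF assms(1-3)]
    by (intro measurable_restrict_space3) auto
  then show ?thesis
    using assms(4) by (auto simp: prob_measures_def cong: measurable_cong_sets)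
qed

lemma pull_law_prob_measures:
  assumes "1 \<le> m" "1 \<le> n" "f \<in> {1..m} \<rightarrow> {1..n}" "\<mu> \<in> prob_measures (\<Omega> n)"
  shows "pull_law m f \<mu> \<in> prob_measures (\<Omega> m)"
  using prob_space.prob_space_distr[OF _ pull_measurable_on[OF assms]] assms(4)
  by (simp add: prob_measures_def pull_law_def)

lemma pull_law_pull_law:
  assumes "1 \<le> k" "1 \<le> m" "1 \<le> n" "g \<in> {1..k} \<rightarrow> {1..m}"
    "f \<in> {1..m} \<rightarrow> {1..n}" "\<mu> \<in> prob_measures (\<Omega> n)"
  shows "pull_law k g (pull_law m f \<mu>) = pull_law k (\<lambda>i. f (g i)) \<mu>"
proof -
  have "pull F k g \<in> measurable (borel_on (\<Omega> m)) (borel_on (\<Omega> k))"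
    using pull_measurable_on[OF assms(1,2,4) pull_law_prob_measures[OF assms(2,3,5,6)]]
    by (simp add: pull_law_def)
  from distr_distr[OF this pull_measurable_on[OF assms(2,3,5,6)]] show ?thesis
    using pull_comp[OF assms(4), of F f] by (simp add: pull_law_def o_def)
qed

lemma pull_law_cong:
  "(\<And>i. i \<in> {1..m} \<Longrightarrow> f i = g i) \<Longrightarrow> pull_law m f \<mu> = pull_law m g \<mu>"
  using pull_cong[of m f g F] by (simp add: pull_law_def)

lemma distr_act_eq_pull_law:
  assumes "1 \<le> n" "\<sigma> \<in> perms n" "\<mu> \<in> prob_measures (\<Omega> n)"
  shows "distr \<mu> (borel_on (\<Omega> n)) (act F n \<sigma>) = pull_law n (inv \<sigma>) \<mu>"
  unfolding pull_law_def using subset[OF assms(1)] space_prob_measures[OF assms(3)]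
  by (intro distr_cong refl act_eq_pull[OF assms(2)]) auto

lemma distr_phi_adj_eq_pull_law:
  assumes "m \<le> n"
  shows "distr \<mu> (borel_on (\<Omega> m)) (phi_adj F n m) = pull_law m (\<lambda>i. i) \<mu>"
  unfolding pull_law_def by (intro distr_cong refl phi_adj_eq_pull[OF assms])

lemma inv_measures_pull_law:
  assumes "1 \<le> n" "\<mu> \<in> inv_measures F n (\<Omega> n)" "p permutes {1..n}"
  shows "pull_law n p \<mu> = \<mu>"
proof -
  \<comment> \<open>The action pulls back along the inverse permutation, so invariance is applied to
    \<open>inv p\<close>.\<close>
  have p: "inv p \<in> perms n"
    using permutes_inv[OF assms(3)] by (simp add: perms_def)
  have "pull_law n (inv (inv p)) \<mu> = \<mu>"
    using distr_act_eq_pull_law[OF assms(1) p, of \<mu>] assms(2) p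
    by (simp add: inv_measures_def del: permutes_inv_inv)
  then show ?thesis
    by (simp only: permutes_inv_inv[OF assms(3)])
qed

section \<open>Laws under uniformly random index maps\<close>

lemma random_map_law_eq_mixture:
  assumes "1 \<le> n" "\<mu> \<in> prob_measures (\<Omega> n)"
  shows "random_map_law F n m (\<Omega> m) \<mu> =
    distr (\<mu> \<Otimes>\<^sub>M uniform_count_measure (index_maps m n)) (borel_on (\<Omega> m)) (\<lambda>(x, f). pull F m f x)"
  unfolding random_map_law_def
  using subset[OF assms(1)] space_prob_measures[OF assms(2)]
  by (intro distr_cong refl) (auto simp: space_pair_measure rho_eq_pull)

lemma random_map_law_mixture_prems:
  assumes "1 \<le> m" "1 \<le> n" "\<mu> \<in> prob_measures (\<Omega> n)"
  shows "prob_space \<mu>" "finite (index_maps m n)" "index_maps m n \<noteq> {}"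
    and "\<And>f. f \<in> index_maps m n \<Longrightarrow> pull F m f \<in> measurable \<mu> (borel_on (\<Omega> m))"
  using assms(3) finite_index_maps index_maps_nonempty[OF assms(2)]
    pull_measurable_on[OF assms(1,2) index_maps_imp_Pi assms(3)]
  by (simp_all only: prob_measures_def mem_Collect_eq not_False_eq_True)

lemma random_map_law_prob_measures:
  assumes "1 \<le> m" "1 \<le> n" "\<mu> \<in> prob_measures (\<Omega> n)"
  shows "random_map_law F n m (\<Omega> m) \<mu> \<in> prob_measures (\<Omega> m)"
  using uniform_mixture_prob[OF random_map_law_mixture_prems[OF assms]]
  by (simp add: random_map_law_eq_mixture[OF assms(2,3)] prob_measures_def)

lemma random_map_law_measure:
  assumes "1 \<le> m" "1 \<le> n" "\<mu> \<in> prob_measures (\<Omega> n)" "A \<in> sets (borel_on (\<Omega> m))"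
  shows "measure (random_map_law F n m (\<Omega> m) \<mu>) A =
    (\<Sum>f\<in>index_maps m n. measure (pull_law m f \<mu>) A) / card (index_maps m n)"
  unfolding random_map_law_eq_mixture[OF assms(2,3)] pull_law_def
  by (rule uniform_mixture_measure[OF random_map_law_mixture_prems[OF assms(1-3)] assms(4)])

lemma random_map_law_integral:
  fixes h :: "vec \<Rightarrow> real"
  assumes "1 \<le> m" "1 \<le> n" "\<mu> \<in> prob_measures (\<Omega> n)" "h \<in> borel_measurable (borel_on (\<Omega> m))"
    and "\<And>y. y \<in> \<Omega> m \<Longrightarrow> \<bar>h y\<bar> \<le> B"
  shows "integral\<^sup>L (random_map_law F n m (\<Omega> m) \<mu>) h =
    (\<Sum>f\<in>index_maps m n. integral\<^sup>L (pull_law m f \<mu>) h) / card (index_maps m n)"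
  unfolding random_map_law_eq_mixture[OF assms(2,3)] pull_law_def
proof (rule uniform_mixture_integral[where B = B, OF random_map_law_mixture_prems[OF assms(1-3)] assms(4)])
  show "\<bar>h y\<bar> \<le> B" if "y \<in> space (borel_on (\<Omega> m))" for y
    using assms(5)[of y] that by simp
qed

text \<open>Passing to preimages lets the averaging formula at level \<open>m\<close> evaluate
  events at level \<open>k\<close>.\<close>

lemma measure_pull_law:
  assumes "1 \<le> k" "1 \<le> m" "g \<in> {1..k} \<rightarrow> {1..m}" "\<mu> \<in> prob_measures (\<Omega> m)"
    and A: "A \<in> sets (borel_on (\<Omega> k))"
  shows "measure (pull_law k g \<mu>) A = measure \<mu> (pull F k g -` A \<inter> \<Omega> m)"
    and "pull F k g -` A \<inter> \<Omega> m \<in> sets (borel_on (\<Omega> m))"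
proof -
  note meas = pull_measurable_on[OF assms(1-4)]
  show "measure (pull_law k g \<mu>) A = measure \<mu> (pull F k g -` A \<inter> \<Omega> m)"
    unfolding pull_law_def measure_distr[OF meas A] space_prob_measures[OF assms(4)] ..
  show "pull F k g -` A \<inter> \<Omega> m \<in> sets (borel_on (\<Omega> m))"
    using measurable_sets[OF meas A] assms(4) space_prob_measures[OF assms(4)]
    by (simp add: prob_measures_def)
qed

text \<open>Pulling back along \<open>g\<close> replaces the random \<open>f\<close> by its
  composite with \<open>g\<close>, which is again uniform since \<open>g\<close> is injective. A
  permutation \<open>g\<close> yields invariance, an inclusion yields compatibility with
  \<open>phi_adj\<close>.\<close>

lemma pull_law_random_map_law:
  assumes "1 \<le> k" "1 \<le> m" "1 \<le> n" "\<mu> \<in> prob_measures (\<Omega> n)"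
    and g: "inj_on g {1..k}" "g ` {1..k} \<subseteq> {1..m}"
  shows "pull_law k g (random_map_law F n m (\<Omega> m) \<mu>) = random_map_law F n k (\<Omega> k) \<mu>"
proof (rule prob_space_measure_eqI)
  let ?R = "random_map_law F n m (\<Omega> m) \<mu>"
  have gi: "g \<in> {1..k} \<rightarrow> {1..m}"
    using g(2) by blast
  have R: "?R \<in> prob_measures (\<Omega> m)"
    using assms by (intro random_map_law_prob_measures)
  note Rk = random_map_law_prob_measures[OF assms(1,3,4)]
    and lawk = pull_law_prob_measures[OF assms(1,2) gi R]
  show "prob_space (pull_law k g ?R)" "prob_space (random_map_law F n k (\<Omega> k) \<mu>)"
    "sets (pull_law k g ?R) = sets (random_map_law F n k (\<Omega> k) \<mu>)"
    using Rk lawk by (simp_all add: prob_measures_def)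
  fix A assume "A \<in> sets (pull_law k g ?R)"
  then have A: "A \<in> sets (borel_on (\<Omega> k))"
    by (simp add: pull_law_def)
  define A' where "A' = pull F k g -` A \<inter> \<Omega> m"
  note pre = measure_pull_law[OF assms(1,2) gi _ A, folded A'_def]
  have "measure (pull_law k g ?R) A = (\<Sum>f\<in>index_maps m n. measure (pull_law m f \<mu>) A') / card (index_maps m n)"
    using random_map_law_measure[OF assms(2-4) pre(2)[OF R]] pre(1)[OF R] by simp
  also have "(\<Sum>f\<in>index_maps m n. measure (pull_law m f \<mu>) A') =
      (\<Sum>f\<in>index_maps m n. measure (pull_law k (\<lambda>i\<in>{1..k}. f (g i)) \<mu>) A)"
  proof (rule sum.cong)
    fix f assume f: "f \<in> index_maps m n"
    then have fi: "f \<in> {1..m} \<rightarrow> {1..n}"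
      by (rule index_maps_imp_Pi)
    have "measure (pull_law m f \<mu>) A' = measure (pull_law k g (pull_law m f \<mu>)) A"
      by (rule pre(1)[OF pull_law_prob_measures[OF assms(2,3) fi assms(4)], symmetric])
    also have "pull_law k g (pull_law m f \<mu>) = pull_law k (\<lambda>i. f (g i)) \<mu>"
      by (rule pull_law_pull_law[OF assms(1-3) gi fi assms(4)])
    also have "\<dots> = pull_law k (\<lambda>i\<in>{1..k}. f (g i)) \<mu>"
      by (rule pull_law_cong) simp
    finally show "measure (pull_law m f \<mu>) A' = measure (pull_law k (\<lambda>i\<in>{1..k}. f (g i)) \<mu>) A" .
  qed simp
  also have "(\<Sum>f\<in>index_maps m n. measure (pull_law k (\<lambda>i\<in>{1..k}. f (g i)) \<mu>) A) / card (index_maps m n) =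
      (\<Sum>f\<in>index_maps k n. measure (pull_law k f \<mu>) A) / card (index_maps k n)"
    by (rule average_precompose[OF assms(3) g])
  also have "\<dots> = measure (random_map_law F n k (\<Omega> k) \<mu>) A"
    by (rule random_map_law_measure[OF assms(1,3,4) A, symmetric])
  finally show "measure (pull_law k g ?R) A = measure (random_map_law F n k (\<Omega> k) \<mu>) A" .
qed

lemma random_map_law_inv_measures:
  assumes "1 \<le> m" "1 \<le> n" "\<mu> \<in> prob_measures (\<Omega> n)"
  shows "random_map_law F n m (\<Omega> m) \<mu> \<in> inv_measures F m (\<Omega> m)"
proof -
  have R: "random_map_law F n m (\<Omega> m) \<mu> \<in> prob_measures (\<Omega> m)"
    by (rule random_map_law_prob_measures[OF assms])
  moreover have "distr (random_map_law F n m (\<Omega> m) \<mu>) (borel_on (\<Omega> m)) (act F m \<sigma>) =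
      random_map_law F n m (\<Omega> m) \<mu>" if "\<sigma> \<in> perms m" for \<sigma>
  proof -
    have inv: "inv \<sigma> permutes {1..m}"
      using that by (simp add: perms_def permutes_inv)
    show ?thesis
      unfolding distr_act_eq_pull_law[OF assms(1) that R]
      using permutes_inj_on[OF inv] permutes_image[OF inv]
      by (intro pull_law_random_map_law assms) auto
  qed
  ultimately show ?thesis
    by (simp add: inv_measures_def)
qed

lemma random_map_seq_inverse_limit:
  assumes "1 \<le> n" "\<mu> \<in> prob_measures (\<Omega> n)"
  shows "random_map_seq F \<Omega> n \<mu> \<in> inverse_limit F \<Omega>"
proof -
  have "distr (random_map_law F n M (\<Omega> M) \<mu>) (borel_on (\<Omega> m)) (phi_adj F M m) =
      random_map_law F n m (\<Omega> m) \<mu>" if "1 \<le> m" "m \<le> M" for m M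
    unfolding distr_phi_adj_eq_pull_law[OF that(2)] using that
    by (intro pull_law_random_map_law assms) simp_all
  moreover have "random_map_seq F \<Omega> n \<mu> \<in> (\<Pi>\<^sub>E m\<in>{1..}. inv_measures F m (\<Omega> m))"
    unfolding random_map_seq_def using random_map_law_inv_measures[OF _ assms]
    by (intro restrict_PiE_iff[THEN iffD2]) simp
  ultimately show ?thesis
    by (simp add: inverse_limit_def random_map_seq_def)
qed

text \<open>Fix the permutation first: acting after duplication pulls back along \<open>e\<close>
  composed with \<open>inv \<pi>\<close>, all of whose fibres have \<open>N div n\<close> elements.
  A uniform map into \<open>{1..N}\<close> followed by it is a uniform map into
  \<open>{1..n}\<close>, so the terms averaged over \<open>\<pi>\<close> are all equal.\<close>

lemma random_map_law_symmetrize: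
  assumes "1 \<le> m" "1 \<le> n" "1 \<le> N" "n dvd N" and \<mu>: "\<mu> \<in> prob_measures (\<Omega> n)"
  shows "random_map_law F N m (\<Omega> m) (symmetrize F \<Omega> N n \<mu>) = random_map_law F n m (\<Omega> m) \<mu>"
proof (rule prob_space_measure_eqI)
  define e where "e i = (i - 1) div (N div n) + 1" for i
  have e: "e i \<in> {1..n}" if "i \<in> {1..N}" for i
    using duplication_index[OF assms(4,3) that] by (simp add: e_def)
  define q where "q \<pi> i = e (inv \<pi> i)" for \<pi> and i :: nat
  have invp: "inv \<pi> permutes {1..N}" if "\<pi> \<in> perms N" for \<pi>
    using that by (simp add: perms_def permutes_inv)
  have inv_mem: "inv \<pi> \<in> {1..N} \<rightarrow> {1..N}" if "\<pi> \<in> perms N" for \<pi>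
    using permutes_in_image[OF invp[OF that]] by blast
  have q: "q \<pi> \<in> {1..N} \<rightarrow> {1..n}" if "\<pi> \<in> perms N" for \<pi>
    unfolding q_def using inv_mem[OF that] e by blast
  have perms: "finite (perms N)" "perms N \<noteq> {}"
    using permutes_id[of "{1..N}"] finite_permutations[of "{1..N}"] unfolding perms_def by blast+
  let ?S = "symmetrize F \<Omega> N n \<mu>"
  have S: "?S = distr (\<mu> \<Otimes>\<^sub>M uniform_count_measure (perms N)) (borel_on (\<Omega> N)) (\<lambda>(x, \<pi>). pull F N (q \<pi>) x)"
    unfolding symmetrize_def
  proof (intro distr_cong refl, clarify)
    fix x \<pi> assume "(x, \<pi>) \<in> space (\<mu> \<Otimes>\<^sub>M uniform_count_measure (perms N))"
    then have x: "x \<in> space_of F n" and \<pi>: "\<pi> \<in> perms N"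
      using subset[OF assms(2)] space_prob_measures[OF \<mu>] by (auto simp: space_pair_measure space_uniform_count_measure)
    have "act F N \<pi> (psi F N n x) = pull F N (inv \<pi>) (pull F N e x)"
      using psi_eq_pull[OF x, of N] act_eq_pull[OF \<pi> pull_in_space] by (simp add: e_def[abs_def])
    also have "\<dots> = pull F N (q \<pi>) x"
      unfolding q_def by (rule pull_comp[OF inv_mem[OF \<pi>]])
    finally show "act F N \<pi> (psi F N n x) = pull F N (q \<pi>) x" .
  qed
  have prob: "prob_space \<mu>"
    using \<mu> by (simp add: prob_measures_def)
  note meas = pull_measurable_on[OF assms(3,2) q \<mu>]
  have S_prob: "?S \<in> prob_measures (\<Omega> N)"
    unfolding S using uniform_mixture_prob[OF prob perms meas] by (simp add: prob_measures_def)
  note Rm = random_map_law_prob_measures[OF assms(1,2) \<mu>]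
    and RS = random_map_law_prob_measures[OF assms(1,3) S_prob]
  show "prob_space (random_map_law F N m (\<Omega> m) ?S)" "prob_space (random_map_law F n m (\<Omega> m) \<mu>)"
    "sets (random_map_law F N m (\<Omega> m) ?S) = sets (random_map_law F n m (\<Omega> m) \<mu>)"
    using Rm RS by (simp_all add: prob_measures_def)
  fix A assume "A \<in> sets (random_map_law F N m (\<Omega> m) ?S)"
  then have A: "A \<in> sets (borel_on (\<Omega> m))"
    using RS by (simp add: prob_measures_def)
  define X where "X f \<pi> = measure (pull_law m (\<lambda>i. q \<pi> (f i)) \<mu>) A" for f \<pi>
  have "measure (pull_law m f ?S) A = (\<Sum>\<pi>\<in>perms N. X f \<pi>) / card (perms N)" if f: "f \<in> index_maps m N" for f
  proof -
    note fi = index_maps_imp_Pi[OF f]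
    define A' where "A' = pull F m f -` A \<inter> \<Omega> N"
    note pre = measure_pull_law[OF assms(1,3) fi _ A, folded A'_def]
    have "measure (pull_law m f ?S) A = measure ?S A'"
      by (rule pre(1)[OF S_prob])
    also have "\<dots> = (\<Sum>\<pi>\<in>perms N. measure (pull_law N (q \<pi>) \<mu>) A') / card (perms N)"
      unfolding S pull_law_def by (rule uniform_mixture_measure[OF prob perms meas pre(2)[OF S_prob]])
    also have "(\<Sum>\<pi>\<in>perms N. measure (pull_law N (q \<pi>) \<mu>) A') = (\<Sum>\<pi>\<in>perms N. X f \<pi>)"
    proof (rule sum.cong)
      fix \<pi> assume \<pi>: "\<pi> \<in> perms N"
      have "measure (pull_law N (q \<pi>) \<mu>) A' = measure (pull_law m f (pull_law N (q \<pi>) \<mu>)) A"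
        by (rule pre(1)[OF pull_law_prob_measures[OF assms(3,2) q[OF \<pi>] \<mu>], symmetric])
      then show "measure (pull_law N (q \<pi>) \<mu>) A' = X f \<pi>"
        using pull_law_pull_law[OF assms(1,3,2) fi q[OF \<pi>] \<mu>] by (simp add: X_def)
    qed simp
    finally show ?thesis .
  qed
  then have "measure (random_map_law F N m (\<Omega> m) ?S) A =
      (\<Sum>f\<in>index_maps m N. (\<Sum>\<pi>\<in>perms N. X f \<pi>) / card (perms N)) / card (index_maps m N)"
    using random_map_law_measure[OF assms(1,3) S_prob A] by simp
  \<comment> \<open>Exchanging the two averages keeps \<open>\<pi>\<close> fixed while
    \<open>f\<close> varies.\<close>
  also have "\<dots> = (\<Sum>\<pi>\<in>perms N. (\<Sum>f\<in>index_maps m N. X f \<pi>) / card (index_maps m N)) / card (perms N)"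
    using sum.swap[of X "perms N" "index_maps m N"] by (simp add: mult.commute flip: sum_divide_distrib)
  also have "(\<Sum>\<pi>\<in>perms N. (\<Sum>f\<in>index_maps m N. X f \<pi>) / card (index_maps m N)) =
      (\<Sum>\<pi>\<in>perms N. measure (random_map_law F n m (\<Omega> m) \<mu>) A)"
  proof (rule sum.cong)
    fix \<pi> assume \<pi>: "\<pi> \<in> perms N"
    have fibres: "card {j \<in> {1..N}. q \<pi> j = t} = N div n" if t: "t \<in> {1..n}" for t
    proof -
      \<comment> \<open>\<open>inv \<pi>\<close> carries the fibres of \<open>q \<pi>\<close>
        bijectively onto the blocks of \<open>e\<close>.\<close>
      have "bij_betw (inv \<pi>) {j \<in> {1..N}. q \<pi> j = t} {j \<in> {1..N}. e j = t}"
        unfolding q_def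
        by (rule bij_betw_subset[OF permutes_imp_bij[OF invp[OF \<pi>]]])
          (use permutes_in_image[OF invp[OF \<pi>]] permutes_surj[OF invp[OF \<pi>]] in \<open>force simp: image_iff surj_def\<close>)+
      then show ?thesis
        using card_duplication_fibre[OF assms(4,3) t] by (simp add: bij_betw_same_card e_def)
    qed
    have "(\<Sum>f\<in>index_maps m N. X f \<pi>) = (\<Sum>f\<in>index_maps m N. measure (pull_law m (\<lambda>i\<in>{1..m}. q \<pi> (f i)) \<mu>) A)"
      unfolding X_def by (intro sum.cong refl arg_cong2[where f = measure] pull_law_cong) simp
    also have "\<dots> / card (index_maps m N) = (\<Sum>f\<in>index_maps m n. measure (pull_law m f \<mu>) A) / card (index_maps m n)"
    proof (rule average_postcompose[OF _ _ fibres])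
      show "q \<pi> ` {1..N} \<subseteq> {1..n}"
        using q[OF \<pi>] by blast
      show "0 < N div n"
        using assms(2-4) by (auto simp: dvd_imp_le div_greater_zero_iff)
    qed
    also have "\<dots> = measure (random_map_law F n m (\<Omega> m) \<mu>) A"
      by (rule random_map_law_measure[OF assms(1,2) \<mu> A, symmetric])
    finally show "(\<Sum>f\<in>index_maps m N. X f \<pi>) / card (index_maps m N) = measure (random_map_law F n m (\<Omega> m) \<mu>) A" .
  qed simp
  also have "\<dots> / card (perms N) = measure (random_map_law F n m (\<Omega> m) \<mu>) A"
    using perms by simp
  finally show "measure (random_map_law F N m (\<Omega> m) ?S) A = measure (random_map_law F n m (\<Omega> m) \<mu>) A" .
qed

section \<open>The sampling map on equivalence classes\<close>

text \<open>Each generating step preserves the sequence, hence so does a chain of steps in either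
  direction.\<close>

lemma random_map_seq_sym_equiv:
  assumes "((n, \<mu>), (N, \<nu>)) \<in> sym_equiv F \<Omega>"
  shows "random_map_seq F \<Omega> N \<nu> = random_map_seq F \<Omega> n \<mu>"
proof -
  have step: "case_prod (random_map_seq F \<Omega>) p = case_prod (random_map_seq F \<Omega>) p'"
    if "(p, p') \<in> sym_step F \<Omega>" for p p'
    using that random_map_law_symmetrize
    by (auto simp: sym_step_def level_measures_def inv_measures_def random_map_seq_def intro!: restrict_ext)
  have "case_prod (random_map_seq F \<Omega>) p' = case_prod (random_map_seq F \<Omega>) p"
    if "(p, p') \<in> sym_equiv F \<Omega>" for p p'
    using that unfolding sym_equiv_def by (induction rule: rtrancl_induct) (auto dest: step)
  from this[OF assms] show ?thesis
    by simp
qed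

text \<open>Constancy on the class turns the set under \<open>the_elem\<close> into a singleton; the
  class is nonempty because it contains \<open>(n, \<mu>)\<close> by reflexivity.\<close>

lemma sampling_map_sym_class:
  "sampling_map F \<Omega> (sym_class F \<Omega> n \<mu>) = random_map_seq F \<Omega> n \<mu>"
proof -
  have "case_prod (random_map_seq F \<Omega>) q = random_map_seq F \<Omega> n \<mu>" if "q \<in> sym_class F \<Omega> n \<mu>" for q
    using that random_map_seq_sym_equiv[of n \<mu> "fst q" "snd q"] by (simp add: sym_class_def case_prod_beta)
  then have "case_prod (random_map_seq F \<Omega>) ` sym_class F \<Omega> n \<mu> =
      (\<lambda>_. random_map_seq F \<Omega> n \<mu>) ` sym_class F \<Omega> n \<mu>"
    by (rule image_cong[OF refl])
  also have "\<dots> = {random_map_seq F \<Omega> n \<mu>}"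
    by (rule image_constant[of "(n, \<mu>)"]) (simp add: sym_class_def sym_equiv_def)
  finally show ?thesis
    by (simp add: sampling_map_def)
qed

lemma sampling_map_inverse_limit:
  assumes "C \<in> direct_limit F \<Omega>"
  shows "sampling_map F \<Omega> C \<in> inverse_limit F \<Omega>"
proof -
  obtain n \<mu> where C: "C = sym_class F \<Omega> n \<mu>" and "(n, \<mu>) \<in> level_measures F \<Omega>"
    using assms unfolding direct_limit_def sym_class_def by (metis quotientE surj_pair)
  then show ?thesis
    using random_map_seq_inverse_limit[of n \<mu>]
    by (simp add: sampling_map_sym_class level_measures_def inv_measures_def)
qed

section \<open>Total variation bound and density\<close>

text \<open>An injection extends to a permutation \<open>p\<close>, so \<open>f\<close> is the
  inclusion followed by \<open>p\<close>, and invariance absorbs \<open>p\<close>.\<close>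

lemma pull_law_injective:
  assumes "1 \<le> m" "m \<le> n" and \<mu>: "\<mu> \<in> inv_measures F n (\<Omega> n)"
    and f: "f \<in> index_maps m n" "inj_on f {1..m}"
  shows "pull_law m f \<mu> = pull_law m (\<lambda>i. i) \<mu>"
proof -
  have n: "1 \<le> n"
    using assms(1,2) by simp
  have "f ` {1..m} \<subseteq> {1..n}"
    using f(1) by (metis PiE_mem image_subsetI)
  then obtain p where p: "p permutes {1..n}" "\<And>i. i \<in> {1..m} \<Longrightarrow> p i = f i"
    using extend_injection_to_permutation[of "{1..n}" "{1..m}" f] f(2) assms(2) by auto
  have "pull_law m f \<mu> = pull_law m p \<mu>"
    using p(2) by (intro pull_law_cong) simp
  also have "\<dots> = pull_law m (\<lambda>i. i) (pull_law n p \<mu>)"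
  proof (rule pull_law_pull_law[OF assms(1) n n, symmetric])
    show "p \<in> {1..n} \<rightarrow> {1..n}"
      using permutes_in_image[OF p(1)] by blast
  qed (use \<mu> assms(2) in \<open>auto simp: inv_measures_def\<close>)
  also have "pull_law n p \<mu> = \<mu>"
    by (rule inv_measures_pull_law[OF n \<mu> p(1)])
  finally show ?thesis .
qed

text \<open>Injective maps give the same integral as the inclusion and drop out. The others
  contribute at most 2 each, as both integrals lie in \<open>[-1, 1]\<close>; this cancels the 2 in
  the denominator of the collision bound.\<close>

lemma random_map_law_integral_diff:
  assumes "1 \<le> m" "m \<le> n" and \<mu>: "\<mu> \<in> inv_measures F n (\<Omega> n)"
    and h: "h \<in> borel_measurable (borel_on (\<Omega> m))" "\<And>y. y \<in> \<Omega> m \<Longrightarrow> \<bar>h y\<bar> \<le> 1"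
  shows "\<bar>integral\<^sup>L (pull_law m (\<lambda>i. i) \<mu>) h - integral\<^sup>L (random_map_law F n m (\<Omega> m) \<mu>) h\<bar>
    \<le> real m * (real m - 1) / real n"
proof -
  define I where "I f = integral\<^sup>L (pull_law m f \<mu>) h" for f
  define J where "J = integral\<^sup>L (pull_law m (\<lambda>i. i) \<mu>) h"
  define B where "B = {f \<in> index_maps m n. \<not> inj_on f {1..m}}"
  have n: "1 \<le> n"
    using assms(1,2) by simp
  then have c: "card (index_maps m n) > 0"
    unfolding card_index_maps by simp
  have \<mu>p: "\<mu> \<in> prob_measures (\<Omega> n)"
    using \<mu> by (simp add: inv_measures_def)
  have bound: "\<bar>integral\<^sup>L (pull_law m f \<mu>) h\<bar> \<le> 1" if "f \<in> {1..m} \<rightarrow> {1..n}" for f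
  proof -
    have law: "pull_law m f \<mu> \<in> prob_measures (\<Omega> m)"
      by (rule pull_law_prob_measures[OF assms(1) n that \<mu>p])
    then interpret L: prob_space "pull_law m f \<mu>"
      by (simp add: prob_measures_def)
    have hm: "h \<in> borel_measurable (pull_law m f \<mu>)"
      using h(1) by (simp add: pull_law_def)
    have "integrable (pull_law m f \<mu>) h"
      using h(2) hm space_prob_measures[OF law] by (intro L.integrable_const_bound[where B = 1]) auto
    then have "\<bar>integral\<^sup>L (pull_law m f \<mu>) h\<bar> \<le> (\<integral>y. \<bar>h y\<bar> \<partial>pull_law m f \<mu>)"
      by (simp add: integral_abs_bound)
    also have "\<dots> \<le> (\<integral>y. 1 \<partial>pull_law m f \<mu>)"
      using \<open>integrable (pull_law m f \<mu>) h\<close> h(2) space_prob_measures[OF law]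
      by (intro integral_mono) auto
    finally show ?thesis
      by (simp add: L.prob_space)
  qed
  have J: "\<bar>J\<bar> \<le> 1"
    unfolding J_def using assms(2) by (intro bound) auto
  have "J - integral\<^sup>L (random_map_law F n m (\<Omega> m) \<mu>) h = (\<Sum>f\<in>index_maps m n. J - I f) / card (index_maps m n)"
    using random_map_law_integral[OF assms(1) n \<mu>p h] c
    by (simp add: I_def sum_subtractf diff_divide_distrib)
  also have "(\<Sum>f\<in>index_maps m n. J - I f) = (\<Sum>f\<in>B. J - I f)"
    using pull_law_injective[OF assms(1-3)]
    by (intro sum.mono_neutral_right) (auto simp: B_def I_def J_def finite_PiE)
  finally have "\<bar>J - integral\<^sup>L (random_map_law F n m (\<Omega> m) \<mu>) h\<bar> = \<bar>\<Sum>f\<in>B. J - I f\<bar> / card (index_maps m n)"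
    by simp
  also have "\<bar>\<Sum>f\<in>B. J - I f\<bar> \<le> (\<Sum>f\<in>B. 2)"
  proof (rule order_trans[OF sum_abs sum_mono])
    fix f assume "f \<in> B"
    then have "\<bar>I f\<bar> \<le> 1"
      unfolding I_def B_def by (intro bound index_maps_imp_Pi) simp
    with J show "\<bar>J - I f\<bar> \<le> 2"
      by linarith
  qed
  also have "(\<Sum>f\<in>B. 2) / card (index_maps m n) = 2 * (real (card B) / card (index_maps m n))"
    by simp
  also have "\<dots> \<le> 2 * (real m * (real m - 1) / (2 * real n))"
    unfolding B_def by (rule mult_left_mono[OF card_noninjective_index_maps[OF assms(2) n]]) simp
  finally show ?thesis
    by (simp add: J_def divide_right_mono)
qed

text \<open>Nonnegativity is recorded for the later sandwich argument. As \<open>tv_dist\<close> is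
  a supremum of reals, it rests on boundedness as well as on the zero test function.\<close>

lemma random_map_law_tv_dist:
  assumes "1 \<le> m" "m \<le> n" and \<mu>: "\<mu> \<in> inv_measures F n (\<Omega> n)"
  defines "d \<equiv> tv_dist (distr \<mu> (borel_on (\<Omega> m)) (phi_adj F n m)) (random_map_law F n m (\<Omega> m) \<mu>)"
  shows "0 \<le> d" "d \<le> real m * (real m - 1) / real n"
proof -
  let ?L = "pull_law m (\<lambda>i. i) \<mu>" and ?R = "random_map_law F n m (\<Omega> m) \<mu>"
  let ?H = "{h \<in> borel_measurable ?L. \<forall>x\<in>space ?L. h x \<in> {-1..1::real}}"
  have d: "d = (SUP h\<in>?H. \<bar>integral\<^sup>L ?L h - integral\<^sup>L ?R h\<bar>)"
    by (simp add: d_def tv_dist_def distr_phi_adj_eq_pull_law[OF assms(2)])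
  have bound: "\<bar>integral\<^sup>L ?L h - integral\<^sup>L ?R h\<bar> \<le> real m * (real m - 1) / real n" if "h \<in> ?H" for h
    using that by (intro random_map_law_integral_diff assms(1-3)) (auto simp: pull_law_def)
  have zero: "(\<lambda>_. 0) \<in> ?H"
    by simp
  show "d \<le> real m * (real m - 1) / real n"
    unfolding d using zero by (intro cSUP_least bound) blast+
  have "\<bar>integral\<^sup>L ?L (\<lambda>_. 0) - integral\<^sup>L ?R (\<lambda>_. 0 :: real)\<bar> \<le> d"
    unfolding d by (intro cSUP_upper zero bdd_aboveI2[where M = "real m * (real m - 1) / real n"] bound)
  then show "0 \<le> d"
    by simp
qed

lemma sampling_map_dense:
  assumes \<mu>: "\<mu> \<in> inverse_limit F \<Omega>"
  shows "\<exists>\<nu> :: nat \<Rightarrow> nat \<Rightarrow> vec measure.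
    (\<forall>n\<ge>1. \<nu> n \<in> sampling_map F \<Omega> ` direct_limit F \<Omega>) \<and>
    (\<forall>m\<ge>1. (\<lambda>n. tv_dist (\<mu> m) (\<nu> n m)) \<longlonglongrightarrow> 0)"
proof -
  define \<nu> where "\<nu> n = sampling_map F \<Omega> (sym_class F \<Omega> n (\<mu> n))" for n
  have inv: "\<mu> n \<in> inv_measures F n (\<Omega> n)" if "1 \<le> n" for n
    using \<mu> that by (auto simp: inverse_limit_def PiE_iff)
  have "\<nu> n \<in> sampling_map F \<Omega> ` direct_limit F \<Omega>" if "1 \<le> n" for n
    unfolding \<nu>_def direct_limit_def sym_class_def using that inv
    by (intro imageI quotientI) (simp add: level_measures_def)
  moreover have "(\<lambda>n. tv_dist (\<mu> m) (\<nu> n m)) \<longlonglongrightarrow> 0" if m: "1 \<le> m" for m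
  proof (rule tendsto_sandwich[where f = "\<lambda>_. 0"])
    \<comment> \<open>Compatibility in the inverse limit rewrites \<open>\<mu> m\<close> as a
      projection of \<open>\<mu> n\<close> once \<open>n \<ge> m\<close>, which suffices for the
      limit.\<close>
    have eq: "tv_dist (\<mu> m) (\<nu> n m) =
        tv_dist (distr (\<mu> n) (borel_on (\<Omega> m)) (phi_adj F n m)) (random_map_law F n m (\<Omega> m) (\<mu> n))"
      if "m \<le> n" for n
      using \<mu> m that by (simp add: inverse_limit_def \<nu>_def sampling_map_sym_class random_map_seq_def)
    show "(\<lambda>n. real m * (real m - 1) / real n) \<longlonglongrightarrow> 0"
      by (rule lim_const_over_n)
    have bounds: "0 \<le> tv_dist (\<mu> m) (\<nu> n m)" "tv_dist (\<mu> m) (\<nu> n m) \<le> real m * (real m - 1) / real n"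
      if "m \<le> n" for n
      using random_map_law_tv_dist[OF m that inv] m that by (simp_all add: eq)
    show "\<forall>\<^sub>F n in sequentially. 0 \<le> tv_dist (\<mu> m) (\<nu> n m)"
      "\<forall>\<^sub>F n in sequentially. tv_dist (\<mu> m) (\<nu> n m) \<le> real m * (real m - 1) / real n"
      by (intro eventually_sequentiallyI[of m] bounds; assumption)+
  qed simp
  ultimately show ?thesis
    by blast
qed

end

lemma pull_closed_sets_space_of: "pull_closed_sets F (space_of F)"
  by unfold_locales auto

text \<open>
  Every map \<open>f : [m] \<rightarrow> [n]\<close> is an injection \<open>g : [m] \<rightarrow> [nm]\<close> followed by the block map
  \<open>[nm] \<rightarrow> [n]\<close>, and \<open>g\<close> extends to a permutation; hence \<open>\<rho>(f)\<close> factors as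
  \<open>\<phi>\<^sup>\<star>\<close> after a permutation after \<open>\<psi>\<close>.
\<close>

lemma pull_closed_setsI:
  assumes subset: "\<And>n. 1 \<le> n \<Longrightarrow> \<Omega> n \<subseteq> space_of F n"
    and invariant: "\<And>n \<sigma>. 1 \<le> n \<Longrightarrow> \<sigma> \<in> perms n \<Longrightarrow> act F n \<sigma> ` \<Omega> n = \<Omega> n"
    and projections: "\<And>n N. 1 \<le> n \<Longrightarrow> n \<le> N \<Longrightarrow> phi_adj F N n ` \<Omega> N \<subseteq> \<Omega> n"
    and embeddings: "\<And>n N. 1 \<le> n \<Longrightarrow> 1 \<le> N \<Longrightarrow> n dvd N \<Longrightarrow> psi F N n ` \<Omega> n \<subseteq> \<Omega> N"
  shows "pull_closed_sets F \<Omega>"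
proof (unfold_locales, rule subset, assumption)
  fix m n :: nat and f :: "nat \<Rightarrow> nat" and x
  assume mn: "1 \<le> m" "1 \<le> n" and f: "f \<in> {1..m} \<rightarrow> {1..n}" and x: "x \<in> \<Omega> n"
  \<comment> \<open>There are \<open>n\<close> blocks of length \<open>m\<close>, and
    \<open>g i\<close> is position \<open>i\<close> of block \<open>f i\<close>. The block records
    \<open>f i\<close> and the position records \<open>i\<close>, so \<open>g\<close> is injective
    whatever \<open>f\<close> is.\<close>
  define N where "N = n * m"
  define e where "e i = (i - 1) div (N div n) + 1" for i
  define g where "g i = (f i - 1) * m + i" for i
  have N: "1 \<le> N" "m \<le> N" "n dvd N" "N div n = m"
    using mn by (auto simp: N_def)
  have eg: "e (g i) = f i" if i: "i \<in> {1..m}" for i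
  proof -
    obtain r where r: "i = Suc r" "r < m"
      using i by (cases i) auto
    then have "(g i - 1) div m = f i - 1"
      by (simp add: g_def)
    then show ?thesis
      using funcset_mem[OF f i] by (simp add: e_def N(4))
  qed
  have "inj_on g {1..m}"
  proof (rule inj_onI)
    fix i j assume ij: "i \<in> {1..m}" "j \<in> {1..m}" "g i = g j"
    then have "f i = f j"
      using eg by metis
    with ij(3) show "i = j"
      by (simp add: g_def)
  qed
  moreover have "g ` {1..m} \<subseteq> {1..N}"
  proof (rule image_subsetI)
    fix i assume i: "i \<in> {1..m}"
    have "(f i - 1) * m + i \<le> (f i - 1) * m + m"
      using i by simp
    also have "\<dots> = f i * m"
      using funcset_mem[OF f i] by (cases "f i") auto
    also have "\<dots> \<le> N"
      using funcset_mem[OF f i] by (simp add: N_def)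
    finally show "g i \<in> {1..N}"
      using i by (simp add: g_def)
  qed
  ultimately obtain p where p: "p permutes {1..N}" "\<And>i. i \<in> {1..m} \<Longrightarrow> p i = g i"
    using extend_injection_to_permutation[of "{1..N}" "{1..m}" g] N(2) by auto
  \<comment> \<open>Acting by \<open>inv p\<close> amounts to pulling back along
    \<open>p\<close>.\<close>
  have ip: "inv p \<in> perms N" "inv (inv p) = p"
    using p(1) by (auto simp: perms_def permutes_inv permutes_inv_inv)
  have "psi F N n x \<in> \<Omega> N"
    using embeddings[OF mn(2) N(1,3)] x by blast
  then have "act F N (inv p) (psi F N n x) \<in> \<Omega> N"
    using invariant[OF N(1) ip(1)] by blast
  then have "phi_adj F N m (act F N (inv p) (psi F N n x)) \<in> \<Omega> m"
    using projections[OF mn(1) N(2)] by blast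
  moreover have "psi F N n x = pull F N e x"
    unfolding e_def[abs_def] using subset[OF mn(2)] x by (intro psi_eq_pull) blast
  ultimately have "pull F m (\<lambda>i. i) (pull F N p (pull F N e x)) \<in> \<Omega> m"
    by (simp add: phi_adj_eq_pull[OF N(2)] act_eq_pull[OF ip(1)] ip(2))
  also have "pull F N p (pull F N e x) = pull F N (\<lambda>i. e (p i)) x"
    using permutes_in_image[OF p(1)] by (intro pull_comp) blast
  also have "pull F m (\<lambda>i. i) \<dots> = pull F m (\<lambda>i. e (p i)) x"
    using N(2) by (intro pull_comp) auto
  also have "pull F m (\<lambda>i. e (p i)) = pull F m f"
    using p(2) eg by (intro pull_cong) simp
  finally show "pull F m f x \<in> \<Omega> m" .
qed

theorem theorem4p5:
  fixes F :: std_constr and \<Omega> :: "nat \<Rightarrow> vec set"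
  assumes subset: "\<And>n. 1 \<le> n \<Longrightarrow> \<Omega> n \<subseteq> space_of F n"
    and invariant: "\<And>n \<sigma>. 1 \<le> n \<Longrightarrow> \<sigma> \<in> perms n \<Longrightarrow> act F n \<sigma> ` \<Omega> n = \<Omega> n"
    and projections: "\<And>n N. 1 \<le> n \<Longrightarrow> n \<le> N \<Longrightarrow> phi_adj F N n ` \<Omega> N \<subseteq> \<Omega> n"
    and embeddings: "\<And>n N. 1 \<le> n \<Longrightarrow> 1 \<le> N \<Longrightarrow> n dvd N \<Longrightarrow> psi F N n ` \<Omega> n \<subseteq> \<Omega> N"
  shows
      "(sampling_map F \<Omega> \<in> direct_limit F \<Omega> \<rightarrow> inverse_limit F \<Omega> \<and>
        (\<forall>n \<mu>. 1 \<le> n \<and> \<mu> \<in> inv_measures F n (\<Omega> n) \<longrightarrow>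
           sampling_map F \<Omega> (sym_class F \<Omega> n \<mu>) = random_map_seq F \<Omega> n \<mu>)) \<and>
       (\<forall>\<mu>\<in>inverse_limit F \<Omega>. \<exists>\<nu> :: nat \<Rightarrow> nat \<Rightarrow> vec measure.
          (\<forall>n\<ge>1. \<nu> n \<in> sampling_map F \<Omega> ` direct_limit F \<Omega>) \<and>
          (\<forall>m\<ge>1. (\<lambda>n. tv_dist (\<mu> m) (\<nu> n m)) \<longlonglongrightarrow> 0)) \<and>
       (\<forall>m n \<mu>. 1 \<le> m \<and> m \<le> n \<and> \<mu> \<in> inv_measures F n (space_of F n) \<longrightarrow>
          tv_dist (distr \<mu> (borel_on (space_of F m)) (phi_adj F n m))
            (random_map_law F n m (space_of F m) \<mu>)
          \<le> real m * (real m - 1) / real n)"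
proof -
  interpret pull_closed_sets F \<Omega>
    using assms by (rule pull_closed_setsI)
  \<comment> \<open>The bound concerns measures on the whole spaces, so it is taken from the
    instance of the locale at \<open>space_of F\<close>.\<close>
  show ?thesis
    using sampling_map_inverse_limit sampling_map_sym_class sampling_map_dense
      pull_closed_sets.random_map_law_tv_dist(2)[OF pull_closed_sets_space_of]
    by blast
qed

end
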